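(* The satisfiability problem for first-order unary-conjunctive-view (UCV) sentences is NEXPTIME-hard.
   Context: A relational vocabulary $\sigma$ is a finite set of relation symbols with arities (no constants, no function symbols). A view over $\sigma$ is a unary conjunctive query without equality and without negation: a formula $V(y)\equiv\exists x_1,\ldots,x_n\,(R_1(u_1)\wedge\cdots\wedge R_k(u_k))$ with exactly one free variable $y$, $R_i\in\sigma$, $u_i$ tuples of variables. For a finite set $\mathcal{V}$ of views over $\sigma$, $\mathrm{UCV}(\sigma,\mathcal{V})$ is the smallest set of formulas containing $V(x)$ for each $V\in\mathcal{V}$ and each variable $x$, closed under $\neg$, $\wedge$, $\exists x$; UCV is the union of all $\mathrm{UCV}(\sigma,\mathcal{V})$. Formulas are interpreted over $\sigma$-structures by expanding the view definitions. *)

theory Defs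
  imports "HOL-Computational_Algebra.Polynomial" "HOL-Library.Countable_Set"
begin

section \<open>Turing machines and complexity classes\<close>

text \<open>
  One machine model is used throughout: Turing machines with finitely many two-way infinite tapes.
  Cells are numbered by integers, tape symbols and states are natural numbers.
  Symbol 0 is the blank, symbols 1 and 2 are the input bits.
  A finite transition relation mentions only finitely many states and symbols, so no separate
  bounds on states and tape alphabet are needed.
\<close>

datatype move = MoveLeft | Stay | MoveRight

record tm =
  tapes :: nat
  start :: nat
  accept :: nat
  delta :: "((nat \<times> nat list) \<times> (nat \<times> (nat \<times> move) list)) set"

definition tm_wf :: "tm \<Rightarrow> bool" where
  "tm_wf M \<longleftrightarrow> tapes M \<ge> 1 \<and> finite (delta M) \<and>
     (\<forall>((q, rs), (q', as)) \<in> delta M.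
        q \<noteq> accept M \<and> length rs = tapes M \<and> length as = tapes M)"

definition deterministic :: "tm \<Rightarrow> bool" where
  "deterministic M \<longleftrightarrow> single_valued (delta M)"

text \<open>A tape is its contents together with the head position.\<close>

type_synonym tape = "(int \<Rightarrow> nat) \<times> int"
type_synonym config = "nat \<times> tape list"

fun shift :: "move \<Rightarrow> int \<Rightarrow> int" where
  "shift MoveLeft h = h - 1"
| "shift Stay h = h"
| "shift MoveRight h = h + 1"

fun scanned :: "tape \<Rightarrow> nat" where
  "scanned (f, h) = f h"

fun act :: "nat \<times> move \<Rightarrow> tape \<Rightarrow> tape" where
  "act (a, m) (f, h) = (f(h := a), shift m h)"

definition step :: "tm \<Rightarrow> config \<Rightarrow> config \<Rightarrow> bool" where
  "step M c c' \<longleftrightarrow> (\<exists>q' as. ((fst c, map scanned (snd c)), (q', as)) \<in> delta M \<and>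
     c' = (q', map2 act as (snd c)))"

definition halted :: "tm \<Rightarrow> config \<Rightarrow> bool" where
  "halted M c \<longleftrightarrow> (\<nexists>c'. step M c c')"

definition word_tape :: "bool list \<Rightarrow> int \<Rightarrow> nat" where
  "word_tape w i =
     (if 0 \<le> i \<and> i < int (length w) then (if w ! nat i then 2 else 1) else 0)"

definition init :: "tm \<Rightarrow> bool list \<Rightarrow> config" where
  "init M w = (start M, (word_tape w, 0) # replicate (tapes M - 1) (\<lambda>_. 0, 0))"

text \<open>All computation paths have to halt within the time bound, on every input; a word is
  accepted if some path reaches the accepting state (from which no transition leads away).\<close>

definition decides_in_time :: "tm \<Rightarrow> bool list set \<Rightarrow> (nat \<Rightarrow> nat) \<Rightarrow> bool" where
  "decides_in_time M L T \<longleftrightarrow> tm_wf M \<and>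
     (\<forall>w. (\<forall>t c. (step M ^^ t) (init M w) c \<longrightarrow> t \<le> T (length w)) \<and>
          (w \<in> L \<longleftrightarrow> (\<exists>c. (step M)\<^sup>*\<^sup>* (init M w) c \<and> fst c = accept M)))"

definition NEXPTIME :: "bool list set set" where
  "NEXPTIME = {L. \<exists>M (p :: nat poly). decides_in_time M L (\<lambda>n. 2 ^ poly p n)}"

text \<open>The output is the complete contents of the last tape when the machine halts.\<close>

definition computes_in_time ::
  "tm \<Rightarrow> (bool list \<Rightarrow> bool list) \<Rightarrow> (nat \<Rightarrow> nat) \<Rightarrow> bool" where
  "computes_in_time M f T \<longleftrightarrow> tm_wf M \<and> deterministic M \<and>
     (\<forall>w. \<exists>t c. t \<le> T (length w) \<and> (step M ^^ t) (init M w) c \<and> halted M c \<and>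
        fst (last (snd c)) = word_tape (f w))"

definition polytime_computable :: "(bool list \<Rightarrow> bool list) \<Rightarrow> bool" where
  "polytime_computable f \<longleftrightarrow> (\<exists>M (p :: nat poly). computes_in_time M f (poly p))"

definition polytime_reducible :: "bool list set \<Rightarrow> bool list set \<Rightarrow> bool" where
  "polytime_reducible A B \<longleftrightarrow> (\<exists>f. polytime_computable f \<and> (\<forall>w. w \<in> A \<longleftrightarrow> f w \<in> B))"

definition NEXPTIME_hard :: "bool list set \<Rightarrow> bool" where
  "NEXPTIME_hard B \<longleftrightarrow> (\<forall>A \<in> NEXPTIME. polytime_reducible A B)"


section \<open>Unary conjunctive view formulas\<close>

text \<open>
  Relation symbols and variables are natural numbers; a vocabulary assigns arities to finitely
  many relation symbols.  \<open>View y xs as\<close> stands for the formula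
  \<open>V(y) \<equiv> \<exists>xs. \<And>as\<close>, where an atom is a relation symbol together with a tuple of variables.
\<close>

type_synonym vocabulary = "nat \<rightharpoonup> nat"

datatype view = View nat "nat list" "(nat \<times> nat list) list"

fun is_view :: "vocabulary \<Rightarrow> view \<Rightarrow> bool" where
  "is_view \<sigma> (View y xs as) \<longleftrightarrow>
     (\<forall>(R, us) \<in> set as. \<sigma> R = Some (length us)) \<and>
     (\<Union>(R, us) \<in> set as. set us) - set xs = {y}"

datatype ucv = At view nat | Neg ucv | And ucv ucv | Ex nat ucv

inductive_set UCV :: "vocabulary \<Rightarrow> view set \<Rightarrow> ucv set"
  for \<sigma> :: vocabulary and \<V> :: "view set" where
  "V \<in> \<V> \<Longrightarrow> is_view \<sigma> V \<Longrightarrow> At V x \<in> UCV \<sigma> \<V>"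
| "\<phi> \<in> UCV \<sigma> \<V> \<Longrightarrow> Neg \<phi> \<in> UCV \<sigma> \<V>"
| "\<phi> \<in> UCV \<sigma> \<V> \<Longrightarrow> \<psi> \<in> UCV \<sigma> \<V> \<Longrightarrow> And \<phi> \<psi> \<in> UCV \<sigma> \<V>"
| "\<phi> \<in> UCV \<sigma> \<V> \<Longrightarrow> Ex x \<phi> \<in> UCV \<sigma> \<V>"

fun fv :: "ucv \<Rightarrow> nat set" where
  "fv (At V x) = {x}"
| "fv (Neg \<phi>) = fv \<phi>"
| "fv (And \<phi> \<psi>) = fv \<phi> \<union> fv \<psi>"
| "fv (Ex x \<phi>) = fv \<phi> - {x}"

definition is_structure :: "vocabulary \<Rightarrow> 'a set \<Rightarrow> (nat \<Rightarrow> 'a list set) \<Rightarrow> bool" where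
  "is_structure \<sigma> D I \<longleftrightarrow> D \<noteq> {} \<and>
     (\<forall>R n. \<sigma> R = Some n \<longrightarrow> I R \<subseteq> {us. set us \<subseteq> D \<and> length us = n})"

text \<open>An atom \<open>V(x)\<close> is evaluated by expanding the definition of \<open>V\<close>, with \<open>y\<close> denoting the
  value of \<open>x\<close>; doing this on assignments avoids renaming the variables \<open>xs\<close>.\<close>

fun view_sat :: "'a set \<Rightarrow> (nat \<Rightarrow> 'a list set) \<Rightarrow> view \<Rightarrow> (nat \<Rightarrow> 'a) \<Rightarrow> nat \<Rightarrow> bool" where
  "view_sat D I (View y xs as) s x \<longleftrightarrow>
     (\<exists>s'. (\<forall>z \<in> set xs. s' z \<in> D) \<and> (\<forall>z. z \<notin> set xs \<longrightarrow> s' z = (s(y := s x)) z) \<and>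
       (\<forall>(R, us) \<in> set as. map s' us \<in> I R))"

fun sat :: "'a set \<Rightarrow> (nat \<Rightarrow> 'a list set) \<Rightarrow> (nat \<Rightarrow> 'a) \<Rightarrow> ucv \<Rightarrow> bool" where
  "sat D I s (At V x) \<longleftrightarrow> view_sat D I V s x"
| "sat D I s (Neg \<phi>) \<longleftrightarrow> \<not> sat D I s \<phi>"
| "sat D I s (And \<phi> \<psi>) \<longleftrightarrow> sat D I s \<phi> \<and> sat D I s \<psi>"
| "sat D I s (Ex x \<phi>) \<longleftrightarrow> (\<exists>a \<in> D. sat D I (s(x := a)) \<phi>)"

definition is_model :: "vocabulary \<Rightarrow> 'a set \<Rightarrow> (nat \<Rightarrow> 'a list set) \<Rightarrow> ucv \<Rightarrow> bool" where
  "is_model \<sigma> D I \<phi> \<longleftrightarrow> is_structure \<sigma> D I \<and> (\<forall>s. range s \<subseteq> D \<longrightarrow> sat D I s \<phi>)"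

text \<open>Quantifying over structures whose domain is a set of natural numbers is no restriction: by
  the downward Loewenheim-Skolem theorem a formula with a model over an arbitrary type has one
  over the natural numbers, see \<open>satisfiable_if_model\<close> below.\<close>

definition satisfiable :: "vocabulary \<Rightarrow> ucv \<Rightarrow> bool" where
  "satisfiable \<sigma> \<phi> \<longleftrightarrow> (\<exists>(D :: nat set) I. is_model \<sigma> D I \<phi>)"


subsection \<open>Formulas as words\<close>

text \<open>
  Formulas are written in prefix notation over the alphabet of bits, each atom carrying the
  definition of its view.  Indices of variables and relation symbols are written in unary.  As a
  formula can be translated in polynomial time from this notation to one with binary indices
  (or one where the view definitions are listed only once), hardness for this notation implies
  hardness for the more succinct ones.
\<close>

fun enc_nat :: "nat \<Rightarrow> bool list" where
  "enc_nat 0 = [False]"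
| "enc_nat (Suc n) = True # enc_nat n"

fun enc_list :: "('a \<Rightarrow> bool list) \<Rightarrow> 'a list \<Rightarrow> bool list" where
  "enc_list e [] = [False]"
| "enc_list e (x # xs) = True # e x @ enc_list e xs"

fun enc_atom :: "nat \<times> nat list \<Rightarrow> bool list" where
  "enc_atom (R, us) = enc_nat R @ enc_list enc_nat us"

fun enc_view :: "view \<Rightarrow> bool list" where
  "enc_view (View y xs as) = enc_nat y @ enc_list enc_nat xs @ enc_list enc_atom as"

fun encode :: "ucv \<Rightarrow> bool list" where
  "encode (At V x) = [False, False] @ enc_view V @ enc_nat x"
| "encode (Neg \<phi>) = [False, True] @ encode \<phi>"
| "encode (And \<phi> \<psi>) = [True, False] @ encode \<phi> @ encode \<psi>"
| "encode (Ex x \<phi>) = [True, True] @ enc_nat x @ encode \<phi>"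

definition UCV_SAT :: "bool list set" where
  "UCV_SAT = {encode \<phi> | \<phi> \<sigma> \<V>. finite (dom \<sigma>) \<and> finite \<V> \<and> (\<forall>V \<in> \<V>. is_view \<sigma> V) \<and>
     \<phi> \<in> UCV \<sigma> \<V> \<and> fv \<phi> = {} \<and> satisfiable \<sigma> \<phi>}"


subsection \<open>The encoding is injective\<close>

lemma enc_nat_prefix: "enc_nat m @ u = enc_nat n @ v \<longleftrightarrow> m = n \<and> u = v"
proof (induction m arbitrary: n)
  case 0 then show ?case by (cases n) auto
next
  case (Suc m) then show ?case by (cases n) auto
qed

lemma enc_list_prefix:
  assumes "\<And>x y u v. e x @ u = e y @ v \<longleftrightarrow> x = y \<and> u = v"
  shows "enc_list e xs @ u = enc_list e ys @ v \<longleftrightarrow> xs = ys \<and> u = v"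
proof (induction xs arbitrary: ys)
  case Nil then show ?case by (cases ys) auto
next
  case (Cons x xs) then show ?case by (cases ys) (auto simp: assms)
qed

lemma enc_atom_prefix: "enc_atom a @ u = enc_atom b @ v \<longleftrightarrow> a = b \<and> u = v"
  by (cases a; cases b) (auto simp: enc_nat_prefix enc_list_prefix)

lemma enc_view_prefix: "enc_view V @ u = enc_view W @ v \<longleftrightarrow> V = W \<and> u = v"
  by (cases V; cases W) (auto simp: enc_nat_prefix enc_atom_prefix enc_list_prefix)

lemma encode_prefix: "encode \<phi> @ u = encode \<psi> @ v \<longleftrightarrow> \<phi> = \<psi> \<and> u = v"
proof (induction \<phi> arbitrary: \<psi> u v)
  case (At V x) then show ?case
    by (cases \<psi>) (auto simp: enc_nat_prefix enc_view_prefix)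
next
  case (Neg \<phi>) then show ?case by (cases \<psi>) auto
next
  case (And \<phi>1 \<phi>2) then show ?case by (cases \<psi>) auto
next
  case (Ex x \<phi>) then show ?case by (cases \<psi>) (auto simp: enc_nat_prefix)
qed

lemma inj_encode: "inj encode"
  using encode_prefix[of _ "[]" _ "[]"] by (auto simp: inj_def)


subsection \<open>Countable models suffice\<close>

lemma view_sat_agree:
  assumes "\<forall>v < Suc (x + sum_list (concat (map snd as))). s v = s' v"
    and "view_sat D I (View y xs as) s x"
  shows "view_sat D I (View y xs as) s' x"
proof -
  let ?m = "Suc (x + sum_list (concat (map snd as)))"
  from assms(2) obtain t where t: "\<forall>z \<in> set xs. t z \<in> D"
    "\<forall>z. z \<notin> set xs \<longrightarrow> t z = (s(y := s x)) z" "\<forall>(R, us) \<in> set as. map t us \<in> I R"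
    by auto
  define t' where "t' z = (if z \<in> set xs then t z else (s'(y := s' x)) z)" for z
  have "map t' us = map t us" if "(R, us) \<in> set as" for R us
  proof (rule map_cong[OF refl])
    fix v assume "v \<in> set us"
    then have "v \<in> set (concat (map snd as))" using that by force
    then have "v < ?m" using member_le_sum_list[of v "concat (map snd as)"] by simp
    then show "t' v = t v" using assms(1) t(2) by (auto simp: t'_def)
  qed
  moreover have "map t us \<in> I R" if "(R, us) \<in> set as" for R us
    using t(3) that by blast
  ultimately have "map t' us \<in> I R" if "(R, us) \<in> set as" for R us
    using that by metis
  then have "\<forall>(R, us) \<in> set as. map t' us \<in> I R" by blast
  moreover have "\<forall>z \<in> set xs. t' z \<in> D" "\<forall>z. z \<notin> set xs \<longrightarrow> t' z = (s'(y := s' x)) z"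
    using t(1) by (simp_all add: t'_def)
  ultimately show ?thesis unfolding view_sat.simps by (intro exI[of _ t'] conjI)
qed

lemma sat_agree:
  "\<exists>m. \<forall>s s'. (\<forall>v < m. s v = s' v) \<longrightarrow> sat D I s \<phi> = sat D I s' \<phi>"
proof (induction \<phi>)
  case (At V x)
  obtain y xs as where V: "V = View y xs as" by (cases V)
  let ?m = "Suc (x + sum_list (concat (map snd as)))"
  have "view_sat D I V s x = view_sat D I V s' x" if *: "\<forall>v < ?m. s v = s' v" for s s'
  proof -
    have "\<forall>v < ?m. s' v = s v" using * by simp
    then show ?thesis unfolding V using view_sat_agree[OF *] view_sat_agree by blast
  qed
  then show ?case unfolding sat.simps by blast
next
  case (Neg \<phi>) then show ?case by simp
next
  case (And \<phi> \<psi>)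
  then obtain m n where mn:
    "\<forall>s s'. (\<forall>v < m. s v = s' v) \<longrightarrow> sat D I s \<phi> = sat D I s' \<phi>"
    "\<forall>s s'. (\<forall>v < n. s v = s' v) \<longrightarrow> sat D I s \<psi> = sat D I s' \<psi>" by blast
  have "sat D I s (And \<phi> \<psi>) = sat D I s' (And \<phi> \<psi>)" if "\<forall>v < max m n. s v = s' v" for s s'
  proof -
    have "\<forall>v < m. s v = s' v" "\<forall>v < n. s v = s' v" using that by auto
    then have "sat D I s \<phi> = sat D I s' \<phi>" "sat D I s \<psi> = sat D I s' \<psi>"
      using mn by blast+
    then show ?thesis by simp
  qed
  then show ?case by blast
next
  case (Ex x \<phi>)
  then obtain m where m:
    "\<forall>s s'. (\<forall>v < m. s v = s' v) \<longrightarrow> sat D I s \<phi> = sat D I s' \<phi>" by blast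
  have "sat D I (s(x := a)) \<phi> = sat D I (s'(x := a)) \<phi>" if "\<forall>v < m. s v = s' v" for s s' a
    using m that by simp
  then show ?case by (intro exI[of _ m]) auto
qed

definition list_asg :: "'a \<Rightarrow> 'a list \<Rightarrow> nat \<Rightarrow> 'a" where
  "list_asg d l n = (if n < length l then l ! n else d)"

lemma list_asg_upd: "\<exists>l'. (list_asg d l)(x := a) = list_asg d l' \<and> set l' \<subseteq> insert a (insert d (set l))"
proof -
  define l' where "l' = map ((list_asg d l)(x := a)) [0..<max (length l) (Suc x)]"
  have "list_asg d l' n = ((list_asg d l)(x := a)) n" for n
    by (cases "n < max (length l) (Suc x)") (auto simp: l'_def list_asg_def)
  moreover have "set l' \<subseteq> insert a (insert d (set l))"
    by (auto simp: l'_def list_asg_def)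
  ultimately show ?thesis by (intro exI[of _ l']) auto
qed

lemma countable_ucv: "countable (UNIV :: ucv set)"
  using inj_encode by (rule countableI')

lemma downward_LS:
  fixes D :: "'a set"
  assumes d: "d \<in> D"
  shows "\<exists>C. C \<subseteq> D \<and> countable C \<and> d \<in> C \<and> (\<forall>l \<psi>. set l \<subseteq> C \<longrightarrow>
       sat D I (list_asg d l) \<psi> = sat C (\<lambda>R. I R \<inter> lists C) (list_asg d l) \<psi>)"
proof -
  define wex where "wex l \<psi> x = (SOME a. a \<in> D \<and> sat D I ((list_asg d l)(x := a)) \<psi>)" for l \<psi> x
  define good where "good l V x s' \<longleftrightarrow> (case V of View y xs as \<Rightarrow>
    (\<forall>z \<in> set xs. s' z \<in> D) \<and> (\<forall>z. z \<notin> set xs \<longrightarrow> s' z = ((list_asg d l)(y := list_asg d l x)) z) \<and>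
       (\<forall>(R, us) \<in> set as. map s' us \<in> I R))" for l V x s'
  define wat where "wat l V x = (SOME s'. good l V x s')" for l V x
  define wit where "wit l \<psi> = insert d (range (wex l \<psi>)) \<union>
     (\<Union>x. case \<psi> of At V z \<Rightarrow> {wat l V z x} | _ \<Rightarrow> {})" for l \<psi>
  have cwit: "countable (wit l \<psi>)" for l \<psi>
    unfolding wit_def by (intro countable_Un countable_insert countable_UN) (auto split: ucv.split)
  define CC where "CC = rec_nat {d} (\<lambda>_ C. C \<union> (D \<inter> (\<Union>l \<in> lists C. \<Union>\<psi>. wit l \<psi>)))"
  have CC: "CC 0 = {d}" "CC (Suc n) = CC n \<union> (D \<inter> (\<Union>l \<in> lists (CC n). \<Union>\<psi>. wit l \<psi>))" for n
    by (simp_all add: CC_def)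
  have cCC: "countable (CC n)" for n
  proof (induction n)
    case (Suc n)
    then have "countable (\<Union>l \<in> lists (CC n). \<Union>\<psi>. wit l \<psi>)"
      using countable_ucv cwit by (intro countable_UN countable_lists) auto
    then show ?case using Suc by (auto simp: CC intro: countable_subset)
  qed (simp add: CC)
  have mono: "CC n \<subseteq> CC m" if "n \<le> m" for n m
    using that by (rule lift_Suc_mono_le[rotated]) (simp add: CC)
  define C where "C = (\<Union>n. CC n)"
  have CD: "C \<subseteq> D"
  proof -
    have "CC n \<subseteq> D" for n by (induction n) (use d in \<open>auto simp: CC\<close>)
    then show ?thesis by (auto simp: C_def)
  qed
  have dC: "d \<in> C" unfolding C_def using CC(1) by blast
  have inC: "\<exists>n. set l \<subseteq> CC n" if "set l \<subseteq> C" for l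
    using that
  proof (induction l)
    case (Cons a l)
    then obtain n m where "set l \<subseteq> CC n" "a \<in> CC m" by (auto simp: C_def)
    then have "set (a # l) \<subseteq> CC (max n m)"
      using mono[of n "max n m"] mono[of m "max n m"] by auto
    then show ?case ..
  qed simp
  have closed: "a \<in> C" if l: "set l \<subseteq> C" and a: "a \<in> D" "a \<in> wit l \<psi>" for l a \<psi>
  proof -
    obtain n where "set l \<subseteq> CC n" using inC[OF l] by blast
    then have "a \<in> CC (Suc n)" using a by (auto simp: CC)
    then show ?thesis by (auto simp: C_def)
  qed
  have asgC: "list_asg d l v \<in> C" if "set l \<subseteq> C" for l v
    using that dC by (auto simp: list_asg_def)
  have main: "set l \<subseteq> C \<Longrightarrow>
    sat D I (list_asg d l) \<psi> = sat C (\<lambda>R. I R \<inter> lists C) (list_asg d l) \<psi>" for l \<psi>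
  proof (induction \<psi> arbitrary: l)
    case (At V x)
    obtain y xs as where V: "V = View y xs as" by (cases V)
    show ?case
    proof
      assume "sat D I (list_asg d l) (At V x)"
      then have "\<exists>s'. good l V x s'" by (auto simp: V good_def)
      then have g: "good l V x (wat l V x)" unfolding wat_def by (rule someI_ex)
      have "wat l V x z \<in> C" for z
      proof (cases "z \<in> set xs")
        case True
        then have "wat l V x z \<in> D" using g by (auto simp: good_def V)
        moreover have "wat l V x z \<in> wit l (At V x)" by (auto simp: wit_def)
        ultimately show ?thesis using closed At by blast
      next
        case False
        then show ?thesis using g asgC[OF At] by (auto simp: good_def V)
      qed
      then have "view_sat C (\<lambda>R. I R \<inter> lists C) V (list_asg d l) x"
        using g unfolding V view_sat.simps
        by (intro exI[of _ "wat l V x"]) (auto simp: good_def V)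
      then show "sat C (\<lambda>R. I R \<inter> lists C) (list_asg d l) (At V x)" by simp
    next
      assume "sat C (\<lambda>R. I R \<inter> lists C) (list_asg d l) (At V x)"
      then obtain t where t: "\<forall>z \<in> set xs. t z \<in> C"
        "\<forall>z. z \<notin> set xs \<longrightarrow> t z = ((list_asg d l)(y := list_asg d l x)) z"
        "\<forall>(R, us) \<in> set as. map t us \<in> I R \<inter> lists C"
        unfolding V sat.simps view_sat.simps by blast
      have "\<forall>z \<in> set xs. t z \<in> D" "\<forall>(R, us) \<in> set as. map t us \<in> I R"
        using t(1,3) CD by blast+
      then show "sat D I (list_asg d l) (At V x)"
        unfolding V sat.simps view_sat.simps using t(2) by blast
    qed
  next
    case (Ex x \<psi>)
    have upd: "sat D I ((list_asg d l)(x := a)) \<psi> =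
        sat C (\<lambda>R. I R \<inter> lists C) ((list_asg d l)(x := a)) \<psi>" if "a \<in> C" for a
    proof -
      obtain l' where l': "(list_asg d l)(x := a) = list_asg d l'"
        "set l' \<subseteq> insert a (insert d (set l))" using list_asg_upd by metis
      then have "set l' \<subseteq> C" using that dC Ex.prems by auto
      then show ?thesis using Ex.IH l'(1) by simp
    qed
    have "wex l \<psi> x \<in> C \<and> sat D I ((list_asg d l)(x := wex l \<psi> x)) \<psi>"
      if "a \<in> D" "sat D I ((list_asg d l)(x := a)) \<psi>" for a
    proof -
      have "wex l \<psi> x \<in> D \<and> sat D I ((list_asg d l)(x := wex l \<psi> x)) \<psi>"
        unfolding wex_def by (rule someI[of _ a]) (use that in blast)
      moreover have "wex l \<psi> x \<in> wit l \<psi>" by (auto simp: wit_def)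
      ultimately show ?thesis using closed Ex.prems by blast
    qed
    then show ?case unfolding sat.simps using upd CD by blast
  qed auto
  have cC: "countable C" unfolding C_def using cCC by auto
  show ?thesis using CD cC dC main by (intro exI[of _ C] conjI allI impI)
qed

lemma sat_image:
  assumes "inj_on f C" "\<And>R. I R \<subseteq> lists C" "range s \<subseteq> C"
  shows "sat (f ` C) (\<lambda>R. map f ` I R) (f \<circ> s) \<phi> = sat C I s \<phi>"
  using assms(3)
proof (induction \<phi> arbitrary: s)
  case (At V x)
  obtain y xs as where V: "V = View y xs as" by (cases V)
  show ?case
  proof
    assume "sat C I s (At V x)"
    then obtain t where t: "\<forall>z \<in> set xs. t z \<in> C"
      "\<forall>z. z \<notin> set xs \<longrightarrow> t z = (s(y := s x)) z" "\<forall>(R, us) \<in> set as. map t us \<in> I R"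
      by (auto simp: V)
    have "map (f \<circ> t) us \<in> map f ` I R" if "(R, us) \<in> set as" for R us
    proof -
      have "map t us \<in> I R" using t(3) that by blast
      then have "map f (map t us) \<in> map f ` I R" by (rule imageI)
      then show ?thesis by simp
    qed
    then have "\<forall>(R, us) \<in> set as. map (f \<circ> t) us \<in> map f ` I R" by blast
    moreover have "\<forall>z \<in> set xs. (f \<circ> t) z \<in> f ` C" using t(1) by simp
    moreover have "\<forall>z. z \<notin> set xs \<longrightarrow> (f \<circ> t) z = ((f \<circ> s)(y := (f \<circ> s) x)) z"
      using t(2) by simp
    ultimately show "sat (f ` C) (\<lambda>R. map f ` I R) (f \<circ> s) (At V x)"
      unfolding V sat.simps view_sat.simps by (intro exI[of _ "f \<circ> t"] conjI)
  next
    assume "sat (f ` C) (\<lambda>R. map f ` I R) (f \<circ> s) (At V x)"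
    then obtain t where t: "\<forall>z \<in> set xs. t z \<in> f ` C"
      "\<forall>z. z \<notin> set xs \<longrightarrow> t z = ((f \<circ> s)(y := (f \<circ> s) x)) z"
      "\<forall>(R, us) \<in> set as. map t us \<in> map f ` I R"
      by (auto simp: V)
    define g where "g = inv_into C f"
    have gf: "g (f a) = a" if "a \<in> C" for a using that assms(1) by (simp add: g_def)
    have sC: "s v \<in> C" for v using At by auto
    have "map (g \<circ> t) us \<in> I R" if as: "(R, us) \<in> set as" for R us
    proof -
      have "map t us \<in> map f ` I R" using t(3) as by blast
      then obtain ws where ws: "ws \<in> I R" "map t us = map f ws" by blast
      then have "set ws \<subseteq> C" using assms(2) by blast
      then have "map g (map f ws) = ws" by (induction ws) (simp_all add: gf)
      then have "map g (map t us) = ws" using ws(2) by simp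
      then show ?thesis using ws(1) by simp
    qed
    then have "\<forall>(R, us) \<in> set as. map (g \<circ> t) us \<in> I R" by blast
    moreover have "\<forall>z \<in> set xs. (g \<circ> t) z \<in> C" using t(1) gf by fastforce
    moreover have "\<forall>z. z \<notin> set xs \<longrightarrow> (g \<circ> t) z = (s(y := s x)) z"
      using t(2) gf sC by auto
    ultimately show "sat C I s (At V x)"
      unfolding V sat.simps view_sat.simps by (intro exI[of _ "g \<circ> t"] conjI)
  qed
next
  case (Ex x \<phi>)
  have "sat (f ` C) (\<lambda>R. map f ` I R) ((f \<circ> s)(x := f a)) \<phi> = sat C I (s(x := a)) \<phi>"
    if "a \<in> C" for a
  proof -
    have "range (s(x := a)) \<subseteq> C" using that Ex.prems by auto
    moreover have "f \<circ> s(x := a) = (f \<circ> s)(x := f a)" by auto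
    ultimately show ?thesis using Ex.IH[of "s(x := a)"] by (simp only:)
  qed
  then show ?case unfolding sat.simps by blast
qed auto

theorem satisfiable_if_model:
  fixes D :: "'a set"
  assumes "is_model \<sigma> D I \<phi>"
  shows "satisfiable \<sigma> \<phi>"
proof -
  obtain d where d: "d \<in> D" using assms by (auto simp: is_model_def is_structure_def)
  obtain C where C: "C \<subseteq> D" "countable C" "d \<in> C"
    "\<forall>l \<psi>. set l \<subseteq> C \<longrightarrow>
       sat D I (list_asg d l) \<psi> = sat C (\<lambda>R. I R \<inter> lists C) (list_asg d l) \<psi>"
    using downward_LS[OF d, of I] by (elim exE conjE)
  let ?I = "\<lambda>R. I R \<inter> lists C"
  define f where "f = to_nat_on C"
  have f: "inj_on f C" unfolding f_def using C(2) by (rule inj_on_to_nat_on)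
  let ?J = "\<lambda>R. map f ` ?I R"
  obtain m where m: "\<forall>s s'. (\<forall>v < m. s v = s' v) \<longrightarrow> sat C ?I s \<phi> = sat C ?I s' \<phi>"
    using sat_agree by blast
  have 1: "sat C ?I s \<phi>" if s: "range s \<subseteq> C" for s
  proof -
    define l where "l = map s [0..<m]"
    have l: "set l \<subseteq> C" using s by (auto simp: l_def)
    have "range (list_asg d l) \<subseteq> D" using l C(1) d nth_mem[of _ l] by (fastforce simp: list_asg_def)
    then have "sat D I (list_asg d l) \<phi>" using assms by (simp add: is_model_def)
    then have "sat C ?I (list_asg d l) \<phi>" using C(4) l by simp
    moreover have "\<forall>v < m. list_asg d l v = s v" by (simp add: list_asg_def l_def)
    ultimately show ?thesis using m by blast
  qed
  have "sat (f ` C) ?J s \<phi>" if s: "range s \<subseteq> f ` C" for s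
  proof -
    define s' where "s' = inv_into C f \<circ> s"
    have "range s' \<subseteq> C" using s by (auto simp: s'_def intro!: inv_into_into)
    moreover have "s = f \<circ> s'"
      using s by (auto simp: s'_def fun_eq_iff f_inv_into_f subset_iff)
    ultimately show ?thesis using 1 sat_image[OF f, of ?I s' \<phi>] by auto
  qed
  moreover have "is_structure \<sigma> (f ` C) ?J"
    unfolding is_structure_def
  proof (intro conjI allI impI)
    show "f ` C \<noteq> {}" using C(3) by blast
    fix R n assume "\<sigma> R = Some n"
    then have "I R \<subseteq> {us. length us = n}" using assms by (auto simp: is_model_def is_structure_def)
    then show "?J R \<subseteq> {us. set us \<subseteq> f ` C \<and> length us = n}" by auto
  qed
  ultimately show ?thesis unfolding satisfiable_def is_model_def by blast
qed

end

theory Submission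
  imports Defs
begin

text \<open>
  A unary atom \<open>R(y)\<close> is a view, so UCV contains monadic first-order logic.  A run of length
  at most \<open>2 ^ (m - 1)\<close> is described by a model whose elements are addressed by a time and a
  position of \<open>m\<close> bits each.  Positions are relative to the heads, so that one step only
  relates elements with equal or adjacent positions at adjacent times.  Unary predicates for
  the carries make incrementing a number expressible by a conjunction of linear size, and the cells
  that hold the input are marked by a chain of predicates starting at the head.  Equality of
  elements is not needed: the axioms force an element with every address to exist, and only exclude
  wrong symbols, so several elements may share an address.

  The resulting formula consists of a constant number of constant pieces and of conjunctions of
  instances of constant templates, indexed by the bits of an address or by the input positions.  Hence it can
  be printed by loops over the input tape and over a counter of polynomial length.
\<close>

section \<open>Structured programs for Turing machines\<close>

text \<open>A symbol claimed at a cell is checked only against the past: it must have been written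
  by the last step or be claimed at the same cell one step earlier, back to time 0, where only the
  initial contents are allowed. Claims that can be traced back like this are true, so the transition
  chosen at a time, which forces claims at the heads, can really be taken. Tracing fails at both
  ends of the range of positions, where the neighbouring cell has no address. As heads move by at
  most one cell per step, this unreliable zone grows inwards by one cell per step. With
  \<open>2 ^ m\<close> positions and the heads in the middle it does not reach them at any time
  below \<open>2 ^ (m - 1)\<close>, hence the bound on the length of runs. Splitting at half the
  range also makes comparisons cheap: the top bit of the time tells that the run must have stopped,
  and the head position \<open>2 ^ (m - 1) - 1\<close> is the number with top bit 0 and all other
  bits 1, which the carry into the top bit detects. Any polynomial is below some
  \<open>(n + c) ^ d\<close>, so the only arithmetic left to the printing machine is repeated
  multiplication by \<open>n + c\<close> in unary.\<close>

datatype prog =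
  Skip | Do nat "nat \<Rightarrow> nat" move | Seq prog prog | While nat prog | Cond nat prog prog

datatype instr = Act nat "nat \<Rightarrow> nat" move | Branch nat "nat \<Rightarrow> nat"

fun exec_instr :: "instr \<Rightarrow> nat \<Rightarrow> nat list \<Rightarrow> nat \<times> (nat \<times> move) list" where
  "exec_instr (Act j f m) q rs = (Suc q, (map (\<lambda>a. (a, Stay)) rs)[j := (f (rs ! j), m)])"
| "exec_instr (Branch j g) q rs = (g (rs ! j), map (\<lambda>a. (a, Stay)) rs)"

fun code_len :: "prog \<Rightarrow> nat" where
  "code_len Skip = 0"
| "code_len (Do j f m) = 1"
| "code_len (Seq p q) = code_len p + code_len q"
| "code_len (While j p) = code_len p + 2"
| "code_len (Cond j p q) = code_len p + code_len q + 2"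

text \<open>\<open>b\<close> is the address of the first instruction, so all jump targets are
  absolute and the machine state is the program counter. Loops stop at a blank; conditionals test
  for the symbol of the bit 1.\<close>

fun compile :: "nat \<Rightarrow> prog \<Rightarrow> instr list" where
  "compile b Skip = []"
| "compile b (Do j f m) = [Act j f m]"
| "compile b (Seq p q) = compile b p @ compile (b + code_len p) q"
| "compile b (While j p) =
     Branch j (\<lambda>a. if a = 0 then b + code_len p + 2 else b + 1) #
     compile (b + 1) p @ [Branch j (\<lambda>_. b)]"
| "compile b (Cond j p q) =
     Branch j (\<lambda>a. if a = 2 then b + 1 else b + code_len p + 2) #
     compile (b + 1) p @ Branch j (\<lambda>_. b + code_len p + code_len q + 2) #
     compile (b + code_len p + 2) q"

lemma length_compile [simp]: "length (compile b p) = code_len p"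
  by (induction p arbitrary: b) auto

text \<open>The number counts machine steps: a loop iteration pays for the test and the jump back, a
  positive branch for the test and the jump over the alternative, a negative branch only for the
  test.\<close>

inductive exec :: "prog \<Rightarrow> tape list \<Rightarrow> nat \<Rightarrow> tape list \<Rightarrow> bool" where
  Skip: "exec Skip ts 0 ts"
| Do: "exec (Do j f m) ts 1 (ts[j := act (f (scanned (ts ! j)), m) (ts ! j)])"
| Seq: "exec p ts n ts' \<Longrightarrow> exec q ts' n' ts'' \<Longrightarrow> exec (Seq p q) ts (n + n') ts''"
| WhileF: "scanned (ts ! j) = 0 \<Longrightarrow> exec (While j p) ts 1 ts"
| WhileT: "scanned (ts ! j) \<noteq> 0 \<Longrightarrow> exec p ts n ts' \<Longrightarrow> exec (While j p) ts' n' ts'' \<Longrightarrow>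
    exec (While j p) ts (n + n' + 2) ts''"
| CondT: "scanned (ts ! j) = 2 \<Longrightarrow> exec p ts n ts' \<Longrightarrow> exec (Cond j p q) ts (n + 2) ts'"
| CondF: "scanned (ts ! j) \<noteq> 2 \<Longrightarrow> exec q ts n ts' \<Longrightarrow> exec (Cond j p q) ts (n + 1) ts'"

text \<open>There are no transitions on symbols above 2, which keeps the transition relation finite.\<close>

definition machine :: "nat \<Rightarrow> instr list \<Rightarrow> tm" where
  "machine k C = \<lparr>tapes = k, start = 0, accept = length C,
     delta = (\<lambda>(q, rs). ((q, rs), exec_instr (C ! q) q rs)) `
       ({..<length C} \<times> {rs. set rs \<subseteq> {..2} \<and> length rs = k})\<rparr>"

fun admissible :: "nat \<Rightarrow> prog \<Rightarrow> bool" where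
  "admissible k Skip \<longleftrightarrow> True"
| "admissible k (Do j f m) \<longleftrightarrow> j < k \<and> (\<forall>a \<le> 2. f a \<le> 2)"
| "admissible k (Seq p q) \<longleftrightarrow> admissible k p \<and> admissible k q"
| "admissible k (While j p) \<longleftrightarrow> j < k \<and> admissible k p"
| "admissible k (Cond j p q) \<longleftrightarrow> j < k \<and> admissible k p \<and> admissible k q"

definition binary_tapes :: "nat \<Rightarrow> tape list \<Rightarrow> bool" where
  "binary_tapes k ts \<longleftrightarrow> length ts = k \<and> (\<forall>(f, h) \<in> set ts. \<forall>i. f i \<le> 2)"

lemma act_id [simp]: "act (scanned t, Stay) t = t"
  by (cases t) auto

lemma step_machine:
  assumes "q < length C" "binary_tapes k ts" "exec_instr (C ! q) q (map scanned ts) = (q', as)"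
  shows "step (machine k C) (q, ts) (q', map2 act as ts)"
proof -
  have "set (map scanned ts) \<subseteq> {..2}" "length (map scanned ts) = k"
    using assms(2) by (fastforce simp: binary_tapes_def)+
  then show ?thesis using assms(1,3)
    by (auto simp: step_def machine_def image_iff intro!: exI[of _ as])
qed

lemma map2_act_id: "map2 act (map (\<lambda>a. (a, Stay)) (map scanned ts)) ts = ts"
  by (induction ts) auto

lemma step_Branch:
  assumes "q < length C" "binary_tapes k ts" "C ! q = Branch j g" "j < k"
  shows "step (machine k C) (q, ts) (g (scanned (ts ! j)), ts)"
proof -
  have "j < length ts" using assms by (simp add: binary_tapes_def)
  then show ?thesis
    using step_machine[OF assms(1,2), of "g (scanned (ts ! j))" "map (\<lambda>a. (a, Stay)) (map scanned ts)"]
    by (simp add: assms(3) map2_act_id del: map_map)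
qed

lemma step_Act:
  assumes "q < length C" "binary_tapes k ts" "C ! q = Act j f m" "j < k"
  shows "step (machine k C) (q, ts) (Suc q, ts[j := act (f (scanned (ts ! j)), m) (ts ! j)])"
proof -
  have j: "j < length ts" using assms by (simp add: binary_tapes_def)
  let ?as = "(map (\<lambda>a. (a, Stay)) (map scanned ts))[j := (f (scanned (ts ! j)), m)]"
  have "map2 act ?as ts = ts[j := act (f (scanned (ts ! j)), m) (ts ! j)]"
    using j by (intro nth_equalityI) (auto simp: nth_list_update)
  then show ?thesis
    using step_machine[OF assms(1,2), of "Suc q" ?as] j by (simp add: assms(3) del: map_map)
qed

lemma binary_tapes_act:
  assumes "binary_tapes k ts" "j < k" "\<forall>a \<le> 2. f a \<le> 2"
  shows "binary_tapes k (ts[j := act (f (scanned (ts ! j)), m) (ts ! j)])"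
proof -
  obtain g h where gh: "ts ! j = (g, h)" by (cases "ts ! j")
  have "(g, h) \<in> set ts" using assms(1,2) gh by (metis binary_tapes_def nth_mem)
  then have "\<forall>i. g i \<le> 2" using assms(1) by (auto simp: binary_tapes_def)
  then show ?thesis using assms set_update_subset_insert[of ts j]
    unfolding binary_tapes_def gh by (fastforce split: if_splits)
qed

definition code_at :: "instr list \<Rightarrow> nat \<Rightarrow> instr list \<Rightarrow> bool" where
  "code_at C b c \<longleftrightarrow> b + length c \<le> length C \<and> (\<forall>i < length c. C ! (b + i) = c ! i)"

lemma code_at_append:
  "code_at C b (c @ c') \<longleftrightarrow> code_at C b c \<and> code_at C (b + length c) c'"
proof -
  have "(\<forall>i < length c + length c'. C ! (b + i) = (c @ c') ! i) \<longleftrightarrow>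
    (\<forall>i < length c. C ! (b + i) = c ! i) \<and> (\<forall>i < length c'. C ! (b + length c + i) = c' ! i)"
    (is "?l \<longleftrightarrow> ?r")
  proof
    assume l: ?l
    have "C ! (b + i) = c ! i" if "i < length c" for i
      using l[rule_format, of i] that by (simp add: nth_append)
    moreover have "C ! (b + length c + i) = c' ! i" if "i < length c'" for i
      using l[rule_format, of "length c + i"] that by (simp add: add.assoc)
    ultimately show ?r by blast
  next
    assume r: ?r
    show ?l
    proof (intro allI impI)
      fix i assume "i < length c + length c'"
      then show "C ! (b + i) = (c @ c') ! i"
        using r[THEN conjunct1, rule_format, of i] r[THEN conjunct2, rule_format, of "i - length c"]
        by (cases "i < length c") (auto simp: nth_append)
    qed
  qed
  then show ?thesis by (auto simp: code_at_def)
qed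

lemma code_at_Cons:
  "code_at C b (i # c) \<longleftrightarrow> b < length C \<and> C ! b = i \<and> code_at C (Suc b) c"
  using code_at_append[of C b "[i]" c] by (auto simp: code_at_def)

text \<open>Induction on the execution with the address \<open>b\<close> kept general: the body of a
  loop starts at \<open>Suc b\<close>, while its remaining iterations start again at
  \<open>b\<close> with the same code.\<close>

lemma exec_compile:
  assumes "exec p ts n ts'" "admissible k p" "binary_tapes k ts" "code_at C b (compile b p)"
  shows "(step (machine k C) ^^ n) (b, ts) (b + code_len p, ts') \<and> binary_tapes k ts'"
  using assms
proof (induction arbitrary: b)
  case (Skip ts)
  then show ?case by simp
next
  case (Do j f m ts)
  then show ?case using step_Act[of b C k ts j f m] binary_tapes_act[of k ts j f m]
    by (auto simp: code_at_Cons simp del: act.simps)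
next
  case (Seq p ts n ts' q n' ts'')
  have "(step (machine k C) ^^ n) (b, ts) (b + code_len p, ts') \<and> binary_tapes k ts'"
    using Seq by (auto simp: code_at_append)
  moreover from this have "(step (machine k C) ^^ n') (b + code_len p, ts')
      (b + code_len p + code_len q, ts'') \<and> binary_tapes k ts''"
    using Seq by (auto simp: code_at_append)
  ultimately show ?case by (auto simp: relpowp_add add.assoc)
next
  case (WhileF ts j p)
  then show ?case using step_Branch[of b C k ts j] by (auto simp: code_at_Cons)
next
  case (WhileT ts j p n ts' n' ts'')
  let ?R = "step (machine k C)"
  have c: "b < length C" "C ! b = Branch j (\<lambda>a. if a = 0 then b + code_len p + 2 else b + 1)"
    "code_at C (Suc b) (compile (Suc b) p)" "Suc b + code_len p < length C"
    "C ! (Suc b + code_len p) = Branch j (\<lambda>_. b)"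
    using WhileT.prems(3) by (auto simp: code_at_Cons code_at_append)
  have jk: "j < k" using WhileT by simp
  have 1: "?R (b, ts) (Suc b, ts)"
    using step_Branch[OF c(1) WhileT.prems(2) c(2) jk] WhileT.hyps(1) by simp
  have 2: "(?R ^^ n) (Suc b, ts) (Suc b + code_len p, ts')" "binary_tapes k ts'"
    using WhileT.IH(1)[OF _ WhileT.prems(2) c(3)] WhileT.prems(1) by auto
  have 3: "?R (Suc b + code_len p, ts') (b, ts')"
    using step_Branch[OF c(4) 2(2) c(5) jk] by simp
  have 4: "(?R ^^ n') (b, ts') (b + code_len (While j p), ts'')" "binary_tapes k ts''"
    using WhileT.IH(2)[OF WhileT.prems(1) 2(2) WhileT.prems(3)] by auto
  have "(?R ^^ (Suc n)) (b, ts) (Suc b + code_len p, ts')"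
    using relpowp_Suc_I2[OF 1 2(1)] .
  then have "(?R ^^ (Suc (Suc n))) (b, ts) (b, ts')" using 3 by (rule relpowp_Suc_I)
  then have "(?R ^^ (Suc (Suc n) + n')) (b, ts) (b + code_len (While j p), ts'')"
    using 4(1) unfolding relpowp_add by blast
  then show ?case using 4(2) by (simp add: add.commute)
next
  case (CondT ts j p n ts' q)
  let ?R = "step (machine k C)"
  have c: "b < length C" "C ! b = Branch j (\<lambda>a. if a = 2 then b + 1 else b + code_len p + 2)"
    "code_at C (Suc b) (compile (Suc b) p)" "Suc b + code_len p < length C"
    "C ! (Suc b + code_len p) = Branch j (\<lambda>_. b + code_len p + code_len q + 2)"
    using CondT.prems(3) by (auto simp: code_at_Cons code_at_append)
  have jk: "j < k" using CondT by simp
  have 1: "?R (b, ts) (Suc b, ts)"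
    using step_Branch[OF c(1) CondT.prems(2) c(2) jk] CondT.hyps(1) by simp
  have 2: "(?R ^^ n) (Suc b, ts) (Suc b + code_len p, ts')" "binary_tapes k ts'"
    using CondT.IH[OF _ CondT.prems(2) c(3)] CondT.prems(1) by auto
  have 3: "?R (Suc b + code_len p, ts') (b + code_len (Cond j p q), ts')"
    using step_Branch[OF c(4) 2(2) c(5) jk] by (simp add: add.assoc)
  have "(?R ^^ (Suc n)) (b, ts) (Suc b + code_len p, ts')"
    using relpowp_Suc_I2[OF 1 2(1)] .
  then have "(?R ^^ (Suc (Suc n))) (b, ts) (b + code_len (Cond j p q), ts')"
    using 3 by (rule relpowp_Suc_I)
  then show ?case using 2(2) by simp
next
  case (CondF ts j q n ts' p)
  let ?R = "step (machine k C)"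
  have c: "b < length C" "C ! b = Branch j (\<lambda>a. if a = 2 then b + 1 else b + code_len p + 2)"
    "code_at C (b + code_len p + 2) (compile (b + code_len p + 2) q)"
    using CondF.prems(3) by (auto simp: code_at_Cons code_at_append)
  have jk: "j < k" using CondF by simp
  have 1: "?R (b, ts) (b + code_len p + 2, ts)"
    using step_Branch[OF c(1) CondF.prems(2) c(2) jk] CondF.hyps(1) by simp
  have 2: "(?R ^^ n) (b + code_len p + 2, ts) (b + code_len p + 2 + code_len q, ts')"
    "binary_tapes k ts'"
    using CondF.IH[OF _ CondF.prems(2) c(3)] CondF.prems(1) by auto
  have "(?R ^^ (Suc n)) (b, ts) (b + code_len p + 2 + code_len q, ts')"
    using relpowp_Suc_I2[OF 1 2(1)] .
  then show ?case using 2(2) by (simp add: ac_simps)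
qed

lemma machine_wf: "k \<ge> 1 \<Longrightarrow> tm_wf (machine k C)"
proof -
  have "length (snd (exec_instr i q rs)) = length rs" for i q rs
    by (cases i) auto
  then show "k \<ge> 1 \<Longrightarrow> tm_wf (machine k C)"
    by (auto simp: tm_wf_def machine_def finite_lists_length_eq) (metis snd_conv)
qed

lemma machine_deterministic: "deterministic (machine k C)"
  by (auto simp: deterministic_def machine_def single_valued_def image_iff) (metis fst_conv, metis snd_conv)

text \<open>Exact step counts are weakened to upper bounds, so that costs can be rounded up whenever
  programs are composed.\<close>

definition run :: "prog \<Rightarrow> tape list \<Rightarrow> nat \<Rightarrow> tape list \<Rightarrow> bool" where
  "run p ts t ts' \<longleftrightarrow> (\<exists>n \<le> t. exec p ts n ts')"

lemma computes_in_time_if_run: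
  assumes "k \<ge> 1" "admissible k p"
    and "\<And>w. \<exists>ts. run p ((word_tape w, 0) # replicate (k - 1) (\<lambda>_. 0, 0)) (T (length w)) ts \<and>
      fst (last ts) = word_tape (f w)"
  shows "computes_in_time (machine k (compile 0 p)) f T"
  unfolding computes_in_time_def
proof (intro conjI allI)
  fix w
  let ?M = "machine k (compile 0 p)"
  let ?ts = "(word_tape w, 0) # replicate (k - 1) (\<lambda>_. 0, 0) :: tape list"
  obtain ts n where ts: "exec p ?ts n ts" "n \<le> T (length w)" "fst (last ts) = word_tape (f w)"
    using assms(3)[of w] by (auto simp: run_def)
  have "binary_tapes k ?ts" using assms(1) by (auto simp: binary_tapes_def word_tape_def)
  then have "(step ?M ^^ n) (0, ?ts) (code_len p, ts)"
    using exec_compile[OF ts(1) assms(2), of "compile 0 p" 0] by (simp add: code_at_def)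
  moreover have "init ?M w = (0, ?ts)" by (simp add: init_def machine_def)
  \<comment> \<open>The state \<open>code_len p\<close> is one past the last instruction, where no
    transition starts.\<close>
  moreover have "halted ?M (code_len p, ts)"
    by (auto simp: halted_def step_def machine_def)
  ultimately show "\<exists>t c. t \<le> T (length w) \<and> (step ?M ^^ t) (init ?M w) c \<and> halted ?M c \<and>
      fst (last (snd c)) = word_tape (f w)"
    using ts(2,3) by (intro exI[of _ n] exI[of _ "(code_len p, ts)"]) simp
qed (use assms(1) in \<open>auto simp: machine_wf machine_deterministic\<close>)

section \<open>Programs on words\<close>

definition word_at :: "bool list \<Rightarrow> nat \<Rightarrow> tape" where
  "word_at u h = (word_tape u, int h)"

definition bit_symbol :: "bool \<Rightarrow> nat" where
  "bit_symbol b = (if b then 2 else 1)"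

lemma scanned_word_at [simp]:
  "scanned (word_at u h) = (if h < length u then bit_symbol (u ! h) else 0)"
  by (auto simp: word_at_def word_tape_def bit_symbol_def)

lemma act_MoveRight_word_at:
  assumes "h < length u"
  shows "act (bit_symbol (u ! h), MoveRight) (word_at u h) = word_at u (Suc h)"
  using assms by (auto simp: word_at_def word_tape_def bit_symbol_def fun_eq_iff)

lemma act_append_word_at:
  "act (bit_symbol b, MoveRight) (word_at u (length u)) = word_at (u @ [b]) (Suc (length u))"
  by (auto simp: word_at_def word_tape_def bit_symbol_def fun_eq_iff nth_append nat_less_iff)

lemma run_mono: "run p ts t ts' \<Longrightarrow> t \<le> t' \<Longrightarrow> run p ts t' ts'"
  unfolding run_def by (meson le_trans)

lemma run_Skip: "run Skip ts t ts"
  unfolding run_def using exec.Skip by blast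

lemma run_Do: "ts' = ts[j := act (f (scanned (ts ! j)), m) (ts ! j)] \<Longrightarrow> run (Do j f m) ts 1 ts'"
  unfolding run_def using exec.Do by blast

lemma run_Seq: "run p ts t ts' \<Longrightarrow> run q ts' t' ts'' \<Longrightarrow> run (Seq p q) ts (t + t') ts''"
  unfolding run_def by (meson add_mono exec.Seq)

lemma run_WhileF: "scanned (ts ! j) = 0 \<Longrightarrow> run (While j p) ts 1 ts"
  unfolding run_def using exec.WhileF by blast

lemma run_WhileT:
  "scanned (ts ! j) \<noteq> 0 \<Longrightarrow> run p ts t ts' \<Longrightarrow> run (While j p) ts' t' ts'' \<Longrightarrow>
    run (While j p) ts (t + t' + 2) ts''"
  unfolding run_def by (meson add_le_mono exec.WhileT order_refl)

lemma run_Cond: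
  assumes "run (if scanned (ts ! j) = 2 then p else q) ts t ts'"
  shows "run (Cond j p q) ts (t + 2) ts'"
proof -
  obtain n where n: "n \<le> t" "exec (if scanned (ts ! j) = 2 then p else q) ts n ts'"
    using assms by (auto simp: run_def)
  show ?thesis
  proof (cases "scanned (ts ! j) = 2")
    case True
    then have "exec (Cond j p q) ts (n + 2) ts'" using n exec.CondT by auto
    then show ?thesis unfolding run_def using n(1) by (meson add_le_mono order_refl)
  next
    case False
    then have "exec (Cond j p q) ts (n + 1) ts'" using n exec.CondF by auto
    then show ?thesis unfolding run_def using n(1) by (intro exI[of _ "n + 1"]) simp
  qed
qed

definition to_end :: "nat \<Rightarrow> prog" where
  "to_end j = While j (Do j (\<lambda>a. a) MoveRight)"

lemma run_to_end:
  assumes "j < length ts" "ts ! j = word_at u h" "h \<le> length u"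
  shows "run (to_end j) ts (3 * (length u - h) + 1) (ts[j := word_at u (length u)])"
  using assms
proof (induction "length u - h" arbitrary: ts h)
  case 0
  then have "h = length u" by simp
  then have "ts[j := word_at u (length u)] = ts" "scanned (ts ! j) = 0"
    using 0 by (simp_all add: list_update_same_conv)
  then show ?case unfolding to_end_def using run_WhileF[of ts j] by (auto intro: run_mono)
next
  case (Suc x)
  let ?ts = "ts[j := word_at u (Suc h)]"
  have h: "h < length u" using Suc by simp
  have 1: "run (Do j (\<lambda>a. a) MoveRight) ts 1 ?ts"
    by (rule run_Do) (use Suc.prems h in \<open>simp add: act_MoveRight_word_at\<close>)
  have 2: "run (to_end j) ?ts (3 * (length u - Suc h) + 1) (?ts[j := word_at u (length u)])"
    by (rule Suc.hyps(1)) (use Suc h in auto)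
  have "scanned (ts ! j) \<noteq> 0" using Suc.prems h by (simp add: bit_symbol_def)
  from run_WhileT[OF this 1 2[unfolded to_end_def]] show ?case
    unfolding to_end_def by simp (erule run_mono, use h in simp)
qed

text \<open>The head may stand on the blank after the word, where the loop would stop at once; hence
  the first move is unconditional. The loop ends on cell -1, which is blank, and the last move leads
  to cell 0.\<close>

definition to_start :: "nat \<Rightarrow> prog" where
  "to_start j = Seq (Do j (\<lambda>a. a) MoveLeft) (Seq (While j (Do j (\<lambda>a. a) MoveLeft)) (Do j (\<lambda>a. a) MoveRight))"

lemma run_left_loop:
  assumes "j < length ts" "ts ! j = (word_tape u, int h - 1)" "h \<le> length u"
  shows "run (While j (Do j (\<lambda>a. a) MoveLeft)) ts (3 * h + 1) (ts[j := (word_tape u, -1)])"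
  using assms
proof (induction h arbitrary: ts)
  case 0
  then have "ts[j := (word_tape u, -1)] = ts" "scanned (ts ! j) = 0"
    by (simp add: list_update_same_conv, simp add: word_tape_def)
  then show ?case using run_WhileF[of ts j] by simp
next
  case (Suc h)
  let ?ts = "ts[j := (word_tape u, int h - 1)]"
  have 1: "run (Do j (\<lambda>a. a) MoveLeft) ts 1 ?ts"
    by (rule run_Do) (use Suc.prems in simp)
  have 2: "run (While j (Do j (\<lambda>a. a) MoveLeft)) ?ts (3 * h + 1) (?ts[j := (word_tape u, -1)])"
    by (rule Suc.IH) (use Suc in auto)
  have "scanned (ts ! j) \<noteq> 0" using Suc.prems by (simp add: word_tape_def)
  from run_WhileT[OF this 1 2] show ?case by simp (erule run_mono, simp)
qed

lemma run_to_start: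
  assumes "j < length ts" "ts ! j = word_at u h" "h \<le> length u"
  shows "run (to_start j) ts (3 * h + 3) (ts[j := word_at u 0])"
proof -
  let ?ts1 = "ts[j := (word_tape u, int h - 1)]"
  let ?ts2 = "ts[j := (word_tape u, -1)]"
  have 1: "run (Do j (\<lambda>a. a) MoveLeft) ts 1 ?ts1"
    by (rule run_Do) (use assms in \<open>simp add: word_at_def\<close>)
  have 2: "run (While j (Do j (\<lambda>a. a) MoveLeft)) ?ts1 (3 * h + 1) ?ts2"
    using run_left_loop[of j ?ts1 u h] assms by simp
  have 3: "run (Do j (\<lambda>a. a) MoveRight) ?ts2 1 (ts[j := word_at u 0])"
    by (rule run_Do) (use assms in \<open>simp add: word_at_def\<close>)
  from run_Seq[OF 1 run_Seq[OF 2 3]] show ?thesis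
    unfolding to_start_def by (rule run_mono) simp
qed

definition append_bit :: "nat \<Rightarrow> bool \<Rightarrow> prog" where
  "append_bit j b = Seq (to_end j) (Seq (Do j (\<lambda>_. bit_symbol b) MoveRight) (to_start j))"

lemma run_append_bit:
  assumes "j < length ts" "ts ! j = word_at u 0"
  shows "run (append_bit j b) ts (8 * (length u + 1)) (ts[j := word_at (u @ [b]) 0])"
proof -
  let ?ts1 = "ts[j := word_at u (length u)]"
  let ?ts2 = "ts[j := word_at (u @ [b]) (length (u @ [b]))]"
  have 1: "run (to_end j) ts (3 * length u + 1) ?ts1"
    using run_to_end[OF assms] by simp
  have 2: "run (Do j (\<lambda>_. bit_symbol b) MoveRight) ?ts1 1 ?ts2"
    by (rule run_Do) (use assms in \<open>simp add: act_append_word_at\<close>)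
  have 3: "run (to_start j) ?ts2 (3 * length (u @ [b]) + 3) (ts[j := word_at (u @ [b]) 0])"
    using run_to_start[of j ?ts2 "u @ [b]" "length (u @ [b])"] assms(1) by simp
  from run_Seq[OF 1 run_Seq[OF 2 3]] show ?thesis
    unfolding append_bit_def by (rule run_mono) simp
qed

fun append_ones :: "nat \<Rightarrow> nat \<Rightarrow> prog" where
  "append_ones j 0 = Skip"
| "append_ones j (Suc n) = Seq (append_bit j True) (append_ones j n)"

lemma run_append_ones:
  assumes "j < length ts" "ts ! j = word_at u 0" "length u + n \<le> L"
  shows "run (append_ones j n) ts (n * (8 * (L + 1))) (ts[j := word_at (u @ replicate n True) 0])"
  using assms
proof (induction n arbitrary: ts u)
  case 0
  then have "ts[j := word_at u 0] = ts" by (simp add: list_update_same_conv)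
  then show ?case by (simp add: run_Skip)
next
  case (Suc n)
  let ?ts = "ts[j := word_at (u @ [True]) 0]"
  have 1: "run (append_bit j True) ts (8 * (L + 1)) ?ts"
    using run_append_bit[of j ts u True] Suc.prems by (auto elim: run_mono)
  have 2: "run (append_ones j n) ?ts (n * (8 * (L + 1)))
      (?ts[j := word_at ((u @ [True]) @ replicate n True) 0])"
    by (rule Suc.IH) (use Suc in auto)
  from run_Seq[OF 1 2] show ?case by simp
qed

definition erase :: "nat \<Rightarrow> prog" where
  "erase j = Seq (to_end j) (Seq (Do j (\<lambda>a. a) MoveLeft)
     (Seq (While j (Do j (\<lambda>_. 0) MoveLeft)) (Do j (\<lambda>a. a) MoveRight)))"

text \<open>Erasing from right to left always leaves the tape of a prefix, so the induction removes
  the last letter.\<close>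

lemma run_erase_loop:
  assumes "j < length ts" "ts ! j = (word_tape u, int (length u) - 1)"
  shows "run (While j (Do j (\<lambda>_. 0) MoveLeft)) ts (3 * length u + 1) (ts[j := (word_tape [], -1)])"
  using assms
proof (induction u arbitrary: ts rule: rev_induct)
  case Nil
  then have "ts[j := (word_tape [], -1)] = ts" "scanned (ts ! j) = 0"
    by (simp add: list_update_same_conv, simp add: word_tape_def)
  then show ?case using run_WhileF[of ts j] by simp
next
  case (snoc b u)
  let ?ts = "ts[j := (word_tape u, int (length u) - 1)]"
  have "(word_tape (u @ [b]))(int (length u) := 0) = word_tape u"
    by (auto simp: word_tape_def fun_eq_iff nth_append nat_less_iff)
  then have 1: "run (Do j (\<lambda>_. 0) MoveLeft) ts 1 ?ts"
    using snoc.prems by (intro run_Do) simp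
  have 2: "run (While j (Do j (\<lambda>_. 0) MoveLeft)) ?ts (3 * length u + 1)
      (?ts[j := (word_tape [], -1)])"
    by (rule snoc.IH) (use snoc in auto)
  have "scanned (ts ! j) \<noteq> 0" using snoc.prems by (simp add: word_tape_def)
  from run_WhileT[OF this 1 2] show ?case by simp (erule run_mono, simp)
qed

lemma run_erase:
  assumes "j < length ts" "ts ! j = word_at u 0"
  shows "run (erase j) ts (6 * length u + 4) (ts[j := word_at [] 0])"
proof -
  let ?ts1 = "ts[j := word_at u (length u)]"
  let ?ts2 = "ts[j := (word_tape u, int (length u) - 1)]"
  let ?ts3 = "ts[j := (word_tape [], -1)]"
  have 1: "run (to_end j) ts (3 * length u + 1) ?ts1"
    using run_to_end[OF assms] by simp
  have 2: "run (Do j (\<lambda>a. a) MoveLeft) ?ts1 1 ?ts2"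
    by (rule run_Do) (use assms in \<open>simp add: word_at_def\<close>)
  have 3: "run (While j (Do j (\<lambda>_. 0) MoveLeft)) ?ts2 (3 * length u + 1) ?ts3"
    using run_erase_loop[of j ?ts2 u] assms by simp
  have 4: "run (Do j (\<lambda>a. a) MoveRight) ?ts3 1 (ts[j := word_at [] 0])"
    by (rule run_Do) (use assms in \<open>simp add: word_at_def\<close>)
  from run_Seq[OF 1 run_Seq[OF 2 run_Seq[OF 3 4]]] show ?thesis
    unfolding erase_def by (rule run_mono) simp
qed

definition for_each :: "nat \<Rightarrow> prog \<Rightarrow> prog \<Rightarrow> prog" where
  "for_each j p q = Seq (While j (Seq (Cond j p q) (Do j (\<lambda>a. a) MoveRight))) (to_start j)"

text \<open>\<open>st h\<close> are the tapes before the body treats letter \<open>h\<close>, and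
  \<open>st' h\<close> those after it; between \<open>st' h\<close> and \<open>st (Suc h)\<close>
  only the head of tape \<open>j\<close> moves. The 8 extra steps per letter are 5 for the tests,
  jumps and the move to the right, and 3 for the way back.\<close>

lemma run_for_each:
  assumes body: "\<And>h. h < length u \<Longrightarrow> run (if u ! h then p else q) (st h) B (st' h)"
    and st: "\<And>h. h \<le> length u \<Longrightarrow> j < length (st h) \<and> st h ! j = word_at u h"
    and st': "\<And>h. h < length u \<Longrightarrow> st' h ! j = word_at u h \<and> st (Suc h) = (st' h)[j := word_at u (Suc h)]"
  shows "run (for_each j p q) (st 0) (length u * (B + 8) + 4) ((st (length u))[j := word_at u 0])"
proof -
  let ?body = "Seq (Cond j p q) (Do j (\<lambda>a. a) MoveRight)"
  have "run (While j ?body) (st h) ((length u - h) * (B + 5) + 1) (st (length u))"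
    if "h \<le> length u" for h
    using that
  proof (induction rule: inc_induct)
    case base
    show ?case using st[of "length u"] run_WhileF by simp
  next
    case (step h)
    have sc: "scanned (st h ! j) = bit_symbol (u ! h)" using st[of h] step by simp
    then have sc2: "scanned (st h ! j) = 2 \<longleftrightarrow> u ! h" by (simp add: bit_symbol_def)
    have 1: "run (Cond j p q) (st h) (B + 2) (st' h)"
      by (rule run_Cond, unfold sc2) (use body[of h] step in simp)
    have 2: "run (Do j (\<lambda>a. a) MoveRight) (st' h) 1 (st (Suc h))"
      by (rule run_Do) (use st'[of h] step in \<open>simp add: act_MoveRight_word_at\<close>)
    have "scanned (st h ! j) \<noteq> 0" using sc by (simp add: bit_symbol_def)
    from run_WhileT[OF this run_Seq[OF 1 2] step.IH]
    have "run (While j ?body) (st h) (B + 5 + ((length u - Suc h) * (B + 5) + 1)) (st (length u))"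
      by (rule run_mono) simp
    moreover have "length u - h = Suc (length u - Suc h)" using step by simp
    ultimately show ?case by simp
  qed
  from this[of 0] have 1: "run (While j ?body) (st 0) (length u * (B + 5) + 1) (st (length u))"
    by simp
  have 2: "run (to_start j) (st (length u)) (3 * length u + 3) ((st (length u))[j := word_at u 0])"
    using run_to_start[of j "st (length u)" u "length u"] st[of "length u"] by simp
  from run_Seq[OF 1 2] show ?thesis
    unfolding for_each_def by (rule run_mono) (simp add: algebra_simps)
qed

section \<open>Printing words that contain a unary loop index\<close>

datatype item = Fixed "bool list" | Index

fun render :: "bool list \<Rightarrow> item list \<Rightarrow> bool list" where
  "render I [] = []"
| "render I (Fixed s # xs) = s @ render I xs"
| "render I (Index # xs) = I @ render I xs"

lemma render_append [simp]: "render I (xs @ ys) = render I xs @ render I ys"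
  by (induction I xs rule: render.induct) auto

text \<open>The tapes hold the input, two unary counters, the current index, and the output.  Only the
  output tape has its head at the end of its word, so that printing a bit takes one step.\<close>

definition store ::
  "bool list \<Rightarrow> nat \<Rightarrow> bool list \<Rightarrow> nat \<Rightarrow> bool list \<Rightarrow> nat \<Rightarrow> bool list \<Rightarrow> nat \<Rightarrow> bool list \<Rightarrow> tape list"
  where
  "store w a N b N' c I d out =
     [word_at w a, word_at N b, word_at N' c, word_at I d, word_at out (length out)]"

lemma store_simps [simp]:
  "length (store w a N b N' c I d out) = 5"
  "store w a N b N' c I d out ! 0 = word_at w a"
  "store w a N b N' c I d out ! Suc 0 = word_at N b"
  "store w a N b N' c I d out ! 2 = word_at N' c"
  "store w a N b N' c I d out ! 3 = word_at I d"
  "store w a N b N' c I d out ! 4 = word_at out (length out)"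
  "(store w a N b N' c I d out)[0 := word_at v e] = store v e N b N' c I d out"
  "(store w a N b N' c I d out)[Suc 0 := word_at v e] = store w a v e N' c I d out"
  "(store w a N b N' c I d out)[2 := word_at v e] = store w a N b v e I d out"
  "(store w a N b N' c I d out)[3 := word_at v e] = store w a N b N' c v e out"
  "(store w a N b N' c I d out)[4 := word_at v (length v)] = store w a N b N' c I d v"
  by (simp_all add: store_def numeral_eq_Suc)

definition put :: "bool \<Rightarrow> prog" where
  "put b = Do 4 (\<lambda>_. bit_symbol b) MoveRight"

lemma run_put:
  "run (put b) (store w a N e N' c I d out) 1 (store w a N e N' c I d (out @ [b]))"
  unfolding put_def
  using store_simps(11)[of w a N e N' c I d out "out @ [b]"]
  by (intro run_Do) (simp add: act_append_word_at)

fun emit :: "item list \<Rightarrow> prog" where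
  "emit [] = Skip"
| "emit (Fixed s # xs) = foldr (\<lambda>b. Seq (put b)) s (emit xs)"
| "emit (Index # xs) = Seq (for_each 3 (put True) (put False)) (emit xs)"

fun emit_cost :: "item list \<Rightarrow> nat" where
  "emit_cost [] = 0"
| "emit_cost (Fixed s # xs) = length s + emit_cost xs"
| "emit_cost (Index # xs) = 9 + emit_cost xs"

lemma run_print_index:
  "run (for_each 3 (put True) (put False)) (store w a N b N' c I 0 out) (length I * 9 + 4)
    (store w a N b N' c I 0 (out @ I))"
proof -
  have "run (for_each 3 (put True) (put False)) (store w a N b N' c I 0 (out @ take 0 I))
    (length I * (1 + 8) + 4)
    ((store w a N b N' c I (length I) (out @ take (length I) I))[3 := word_at I 0])"
  proof (rule run_for_each[where st = "\<lambda>h. store w a N b N' c I h (out @ take h I)"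
        and st' = "\<lambda>h. store w a N b N' c I h (out @ take (Suc h) I)"])
    fix h assume "h < length I"
    then show "run (if I ! h then put True else put False) (store w a N b N' c I h (out @ take h I)) 1
      (store w a N b N' c I h (out @ take (Suc h) I))"
      using run_put[of "I ! h" w a N b N' c I h "out @ take h I"]
      by (auto simp: take_Suc_conv_app_nth)
  qed auto
  then show ?thesis by simp
qed

lemma run_emit:
  assumes "length I \<le> L"
  shows "run (emit xs) (store w a N b N' c I 0 out) (emit_cost xs * (L + 1))
    (store w a N b N' c I 0 (out @ render I xs))"
proof (induction xs arbitrary: out rule: emit.induct)
  case 1
  then show ?case by (simp add: run_Skip)
next
  case (2 s xs)
  have "run (foldr (\<lambda>b. Seq (put b)) s (emit xs)) (store w a N b N' c I 0 out)
    (length s + emit_cost xs * (L + 1)) (store w a N b N' c I 0 (out @ s @ render I xs))"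
  proof (induction s arbitrary: out)
    case Nil
    then show ?case using 2 by simp
  next
    case (Cons x s)
    from run_Seq[OF run_put Cons[of "out @ [x]"]] show ?case by simp
  qed
  then show ?case by (auto elim: run_mono)
next
  case (3 xs)
  from run_Seq[OF run_print_index 3[of "out @ I"]] show ?case
    by simp (erule run_mono, use assms in \<open>simp add: algebra_simps\<close>)
qed

datatype cmd = Emit "bool list" | LoopN "item list" "item list"
  | LoopW "item list" "item list" "item list"

text \<open>Indexed relation symbols are numbered in steps of 7. Since numbers are encoded in unary,
  \<open>ones i\<close> in front of \<open>enc_nat R\<close> is the code of
  \<open>7 * i + R\<close>.\<close>

definition ones :: "nat \<Rightarrow> bool list" where
  "ones i = replicate (7 * i) True"

lemma ones_0 [simp]: "ones 0 = []"
  by (simp add: ones_def)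

lemma ones_Suc: "ones (Suc i) = ones i @ replicate 7 True"
  by (simp add: ones_def replicate_add[symmetric])

text \<open>After the last round the index equals the bound, and \<open>ys\<close> is printed with
  that value. This reaches the symbols just past the range, such as the carry out of a
  number.\<close>

fun cmd_output :: "bool list \<Rightarrow> nat \<Rightarrow> cmd \<Rightarrow> bool list" where
  "cmd_output w m (Emit s) = s"
| "cmd_output w m (LoopN xs ys) =
     concat (map (\<lambda>i. render (ones i) xs) [0..<m]) @ render (ones m) ys"
| "cmd_output w m (LoopW xs xs' ys) =
     concat (map (\<lambda>i. render (ones i) (if w ! i then xs' else xs)) [0..<length w]) @
     render (ones (length w)) ys"

fun cmd_prog :: "cmd \<Rightarrow> prog" where
  "cmd_prog (Emit s) = emit [Fixed s]"
| "cmd_prog (LoopN xs ys) =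
     Seq (for_each 1 (Seq (emit xs) (append_ones 3 7)) (Seq (emit xs) (append_ones 3 7)))
       (Seq (emit ys) (erase 3))"
| "cmd_prog (LoopW xs xs' ys) =
     Seq (for_each 0 (Seq (emit xs') (append_ones 3 7)) (Seq (emit xs) (append_ones 3 7)))
       (Seq (emit ys) (erase 3))"

fun cmd_cost :: "cmd \<Rightarrow> nat" where
  "cmd_cost (Emit s) = length s"
| "cmd_cost (LoopN xs ys) = emit_cost xs + emit_cost ys + 90"
| "cmd_cost (LoopW xs xs' ys) = emit_cost xs + emit_cost xs' + emit_cost ys + 90"

lemma loop_cost:
  fixes n L A C E :: nat
  assumes "n \<le> L"  "A \<le> C"
  shows "n * (A * (L + 1) + 7 * (8 * (L + 1)) + 8) + 4 + (E * (L + 1) + (6 * L + 4)) \<le>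
    (C + E + 90) * (L + 1)\<^sup>2"
proof -
  have "n * (A * (L + 1) + 7 * (8 * (L + 1)) + 8) \<le> L * (C * (L + 1) + 7 * (8 * (L + 1)) + 8)"
    using assms by (intro mult_le_mono add_le_mono) auto
  also have "\<dots> + 4 + (E * (L + 1) + (6 * L + 4)) \<le> (C + E + 90) * (L + 1)\<^sup>2"
    by (simp add: power2_eq_square algebra_simps)
  finally show ?thesis by simp
qed

lemma run_cmd:
  assumes "7 * length w \<le> L" "7 * m \<le> L"
  shows "run (cmd_prog x) (store w 0 (replicate m True) 0 [] 0 [] 0 out) (cmd_cost x * (L + 1)\<^sup>2)
    (store w 0 (replicate m True) 0 [] 0 [] 0 (out @ cmd_output w m x))"
proof -
  let ?N = "replicate m True"
  have body: "run (Seq (emit xs) (append_ones 3 7)) (store w a ?N b [] 0 (ones h) 0 out)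
      (emit_cost xs * (L + 1) + 7 * (8 * (L + 1)))
      (store w a ?N b [] 0 (ones (Suc h)) 0 (out @ render (ones h) xs))"
    if "7 * Suc h \<le> L" for h xs a b out
  proof (rule run_Seq)
    show "run (emit xs) (store w a ?N b [] 0 (ones h) 0 out) (emit_cost xs * (L + 1))
        (store w a ?N b [] 0 (ones h) 0 (out @ render (ones h) xs))"
      by (rule run_emit) (use that in \<open>simp add: ones_def\<close>)
    show "run (append_ones 3 7) (store w a ?N b [] 0 (ones h) 0 (out @ render (ones h) xs))
        (7 * (8 * (L + 1))) (store w a ?N b [] 0 (ones (Suc h)) 0 (out @ render (ones h) xs))"
      using run_append_ones[of 3 "store w a ?N b [] 0 (ones h) 0 (out @ render (ones h) xs)"
          "ones h" 7 L] that
      by (simp add: ones_Suc) (simp add: ones_def)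
  qed
  have rest: "run (Seq (emit ys) (erase 3)) (store w 0 ?N 0 [] 0 (ones h) 0 out)
      (emit_cost ys * (L + 1) + (6 * L + 4))
      (store w 0 ?N 0 [] 0 [] 0 (out @ render (ones h) ys))"
    if "7 * h \<le> L" for h ys out
  proof (rule run_Seq)
    show "run (emit ys) (store w 0 ?N 0 [] 0 (ones h) 0 out) (emit_cost ys * (L + 1))
        (store w 0 ?N 0 [] 0 (ones h) 0 (out @ render (ones h) ys))"
      by (rule run_emit) (use that in \<open>simp add: ones_def\<close>)
    show "run (erase 3) (store w 0 ?N 0 [] 0 (ones h) 0 (out @ render (ones h) ys)) (6 * L + 4)
        (store w 0 ?N 0 [] 0 [] 0 (out @ render (ones h) ys))"
      using run_erase[of 3 "store w 0 ?N 0 [] 0 (ones h) 0 (out @ render (ones h) ys)" "ones h"] that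
      by simp (erule run_mono, simp add: ones_def)
  qed
  show ?thesis
  proof (cases x)
    case (Emit s)
    have "run (emit [Fixed s]) (store w 0 ?N 0 [] 0 [] 0 out) (emit_cost [Fixed s] * (L + 1))
      (store w 0 ?N 0 [] 0 [] 0 (out @ render [] [Fixed s]))"
      by (rule run_emit) simp
    then show ?thesis unfolding Emit by simp (erule run_mono, simp add: power2_eq_square)
  next
    case (LoopN xs ys)
    let ?out = "\<lambda>h. out @ concat (map (\<lambda>i. render (ones i) xs) [0..<h])"
    let ?p = "Seq (emit xs) (append_ones 3 7)"
    have "run (for_each 1 ?p ?p) (store w 0 ?N 0 [] 0 (ones 0) 0 (?out 0))
      (length ?N * (emit_cost xs * (L + 1) + 7 * (8 * (L + 1)) + 8) + 4)
      ((store w 0 ?N (length ?N) [] 0 (ones (length ?N)) 0 (?out (length ?N)))[1 := word_at ?N 0])"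
    proof (rule run_for_each[where st = "\<lambda>h. store w 0 ?N h [] 0 (ones h) 0 (?out h)"
          and st' = "\<lambda>h. store w 0 ?N h [] 0 (ones (Suc h)) 0 (?out (Suc h))"])
      fix h assume "h < length ?N"
      then show "run (if ?N ! h then ?p else ?p) (store w 0 ?N h [] 0 (ones h) 0 (?out h))
        (emit_cost xs * (L + 1) + 7 * (8 * (L + 1)))
        (store w 0 ?N h [] 0 (ones (Suc h)) 0 (?out (Suc h)))"
        using body[of h xs 0 h "?out h"] assms by simp
    qed auto
    then have 1: "run (for_each 1 ?p ?p) (store w 0 ?N 0 [] 0 [] 0 out)
      (m * (emit_cost xs * (L + 1) + 7 * (8 * (L + 1)) + 8) + 4)
      (store w 0 ?N 0 [] 0 (ones m) 0 (?out m))"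
      by simp
    from run_Seq[OF 1 rest[of m ys "?out m"]] assms(2)
    have "run (cmd_prog x) (store w 0 ?N 0 [] 0 [] 0 out)
      (m * (emit_cost xs * (L + 1) + 7 * (8 * (L + 1)) + 8) + 4 +
        (emit_cost ys * (L + 1) + (6 * L + 4)))
      (store w 0 ?N 0 [] 0 [] 0 (out @ cmd_output w m x))"
      by (simp add: LoopN)
    then show ?thesis
      by (rule run_mono) (use loop_cost[of m L "emit_cost xs"] assms in \<open>simp add: LoopN\<close>)
  next
    case (LoopW xs xs' ys)
    let ?out = "\<lambda>h. out @ concat (map (\<lambda>i. render (ones i) (if w ! i then xs' else xs)) [0..<h])"
    let ?p = "\<lambda>xs. Seq (emit xs) (append_ones 3 7)"
    let ?e = "emit_cost xs + emit_cost xs'"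
    have "run (for_each 0 (?p xs') (?p xs)) (store w 0 ?N 0 [] 0 (ones 0) 0 (?out 0))
      (length w * (?e * (L + 1) + 7 * (8 * (L + 1)) + 8) + 4)
      ((store w (length w) ?N 0 [] 0 (ones (length w)) 0 (?out (length w)))[0 := word_at w 0])"
    proof (rule run_for_each[where st = "\<lambda>h. store w h ?N 0 [] 0 (ones h) 0 (?out h)"
          and st' = "\<lambda>h. store w h ?N 0 [] 0 (ones (Suc h)) 0 (?out (Suc h))"])
      fix h assume h: "h < length w"
      have "run (?p (if w ! h then xs' else xs)) (store w h ?N 0 [] 0 (ones h) 0 (?out h))
        (?e * (L + 1) + 7 * (8 * (L + 1)))
        (store w h ?N 0 [] 0 (ones (Suc h)) 0 (?out (Suc h)))"
        using body[of h "if w ! h then xs' else xs" h 0 "?out h"] assms h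
        by (auto elim!: run_mono simp: add_mult_distrib)
      then show "run (if w ! h then ?p xs' else ?p xs) (store w h ?N 0 [] 0 (ones h) 0 (?out h))
        (?e * (L + 1) + 7 * (8 * (L + 1)))
        (store w h ?N 0 [] 0 (ones (Suc h)) 0 (?out (Suc h)))"
        by (simp split: if_splits)
    qed auto
    then have 1: "run (for_each 0 (?p xs') (?p xs)) (store w 0 ?N 0 [] 0 [] 0 out)
      (length w * (?e * (L + 1) + 7 * (8 * (L + 1)) + 8) + 4)
      (store w 0 ?N 0 [] 0 (ones (length w)) 0 (?out (length w)))"
      by simp
    from run_Seq[OF 1 rest[of "length w" ys "?out (length w)"]] assms(1)
    have "run (cmd_prog x) (store w 0 ?N 0 [] 0 [] 0 out)
      (length w * (?e * (L + 1) + 7 * (8 * (L + 1)) + 8) + 4 +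
        (emit_cost ys * (L + 1) + (6 * L + 4)))
      (store w 0 ?N 0 [] 0 [] 0 (out @ cmd_output w m x))"
      by (simp add: LoopW)
    then show ?thesis
      by (rule run_mono) (use loop_cost[of "length w" L ?e] assms in \<open>simp add: LoopW\<close>)
  qed
qed

fun cmds_prog :: "cmd list \<Rightarrow> prog" where
  "cmds_prog [] = Skip"
| "cmds_prog (x # xs) = Seq (cmd_prog x) (cmds_prog xs)"

lemma run_cmds:
  assumes "7 * length w \<le> L" "7 * m \<le> L"
  shows "run (cmds_prog xs) (store w 0 (replicate m True) 0 [] 0 [] 0 out)
    (sum_list (map cmd_cost xs) * (L + 1)\<^sup>2)
    (store w 0 (replicate m True) 0 [] 0 [] 0 (out @ concat (map (cmd_output w m) xs)))"
proof (induction xs arbitrary: out)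
  case Nil
  then show ?case by (simp add: run_Skip)
next
  case (Cons x xs)
  from run_Seq[OF run_cmd[OF assms, of x out] Cons] show ?case by (simp add: algebra_simps)
qed

section \<open>Computing a power of \<open>length w + c\<close> in unary\<close>

definition times_input :: "nat \<Rightarrow> prog" where
  "times_input c =
     (let p = Seq (append_ones 2 c) (for_each 0 (append_ones 2 1) (append_ones 2 1)) in
      Seq (for_each 1 p p) (Seq (erase 1) (Seq (for_each 2 (append_ones 1 1) (append_ones 1 1)) (erase 2))))"

text \<open>Each of the \<open>m\<close> marks on tape 1 appends \<open>c\<close> marks and one mark
  per input letter to tape 2; the product is then copied back to the erased tape 1, and tape 2 is
  cleared for the next use.\<close>

lemma run_times_input:
  assumes "m \<le> L" "m * (length w + c) \<le> L" "length w \<le> L" "c \<le> L"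
  shows "run (times_input c) (store w 0 (replicate m True) 0 [] 0 [] 0 out) (100 * (L + 1) ^ 3)
    (store w 0 (replicate (m * (length w + c)) True) 0 [] 0 [] 0 out)"
proof -
  let ?n = "length w"
  let ?r = "\<lambda>n. replicate n True"
  let ?a = "append_ones 2 1"
  have inner: "run (for_each 0 ?a ?a) (store w 0 (?r m) h (?r l) 0 [] 0 out) (?n * (8 * (L + 1) + 8) + 4)
      (store w 0 (?r m) h (?r (l + ?n)) 0 [] 0 out)" if "l + ?n \<le> L" for l h
  proof -
    have "run (for_each 0 ?a ?a) (store w 0 (?r m) h (?r (l + 0)) 0 [] 0 out) (?n * (8 * (L + 1) + 8) + 4)
      ((store w ?n (?r m) h (?r (l + ?n)) 0 [] 0 out)[0 := word_at w 0])"
    proof (rule run_for_each[where st = "\<lambda>i. store w i (?r m) h (?r (l + i)) 0 [] 0 out"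
          and st' = "\<lambda>i. store w i (?r m) h (?r (l + Suc i)) 0 [] 0 out"])
      fix i assume "i < length w"
      then show "run (if w ! i then ?a else ?a) (store w i (?r m) h (?r (l + i)) 0 [] 0 out) (8 * (L + 1))
        (store w i (?r m) h (?r (l + Suc i)) 0 [] 0 out)"
        using run_append_ones[of 2 "store w i (?r m) h (?r (l + i)) 0 [] 0 out" "?r (l + i)" 1 L] that
        by (simp add: replicate_append_same del: append_ones.simps)
    qed auto
    then show ?thesis by simp
  qed
  let ?p = "Seq (append_ones 2 c) (for_each 0 ?a ?a)"
  let ?B = "c * (8 * (L + 1)) + (?n * (8 * (L + 1) + 8) + 4)"
  have body: "run ?p (store w 0 (?r m) h (?r l) 0 [] 0 out) ?B
      (store w 0 (?r m) h (?r (l + (?n + c))) 0 [] 0 out)" if "l + (?n + c) \<le> L" for l h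
  proof (rule run_Seq)
    show "run (append_ones 2 c) (store w 0 (?r m) h (?r l) 0 [] 0 out) (c * (8 * (L + 1)))
      (store w 0 (?r m) h (?r (l + c)) 0 [] 0 out)"
      using run_append_ones[of 2 "store w 0 (?r m) h (?r l) 0 [] 0 out" "?r l" c L] that
      by (simp add: replicate_add)
    show "run (for_each 0 ?a ?a) (store w 0 (?r m) h (?r (l + c)) 0 [] 0 out)
      (?n * (8 * (L + 1) + 8) + 4) (store w 0 (?r m) h (?r (l + (?n + c))) 0 [] 0 out)"
      using inner[of "l + c" h] that by (simp add: ac_simps)
  qed
  have 1: "run (for_each 1 ?p ?p) (store w 0 (?r m) 0 [] 0 [] 0 out) (m * (?B + 8) + 4)
      (store w 0 (?r m) 0 (?r (m * (?n + c))) 0 [] 0 out)"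
  proof -
    have "run (for_each 1 ?p ?p) (store w 0 (?r m) 0 (?r (0 * (?n + c))) 0 [] 0 out)
      (length (?r m) * (?B + 8) + 4)
      ((store w 0 (?r m) (length (?r m)) (?r (length (?r m) * (?n + c))) 0 [] 0 out)[1 := word_at (?r m) 0])"
    proof (rule run_for_each[where st = "\<lambda>h. store w 0 (?r m) h (?r (h * (?n + c))) 0 [] 0 out"
          and st' = "\<lambda>h. store w 0 (?r m) h (?r (Suc h * (?n + c))) 0 [] 0 out"])
      fix h assume "h < length (?r m)"
      then have "Suc h * (?n + c) \<le> m * (?n + c)" by (intro mult_le_mono) auto
      then have "h * (?n + c) + (?n + c) \<le> L" using assms(2) by simp
      from body[OF this, of h]
      show "run (if ?r m ! h then ?p else ?p) (store w 0 (?r m) h (?r (h * (?n + c))) 0 [] 0 out) ?B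
        (store w 0 (?r m) h (?r (Suc h * (?n + c))) 0 [] 0 out)"
        by (simp add: ac_simps)
    qed auto
    then show ?thesis by simp
  qed
  let ?l = "m * (?n + c)"
  have 2: "run (erase 1) (store w 0 (?r m) 0 (?r ?l) 0 [] 0 out) (6 * m + 4)
      (store w 0 [] 0 (?r ?l) 0 [] 0 out)"
    using run_erase[of 1 "store w 0 (?r m) 0 (?r ?l) 0 [] 0 out" "?r m"] by simp
  let ?a' = "append_ones 1 1"
  have 3: "run (for_each 2 ?a' ?a') (store w 0 [] 0 (?r ?l) 0 [] 0 out) (?l * (8 * (L + 1) + 8) + 4)
      (store w 0 (?r ?l) 0 (?r ?l) 0 [] 0 out)"
  proof -
    have "run (for_each 2 ?a' ?a') (store w 0 (?r 0) 0 (?r ?l) 0 [] 0 out)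
      (length (?r ?l) * (8 * (L + 1) + 8) + 4)
      ((store w 0 (?r (length (?r ?l))) 0 (?r ?l) (length (?r ?l)) [] 0 out)[2 := word_at (?r ?l) 0])"
    proof (rule run_for_each[where st = "\<lambda>i. store w 0 (?r i) 0 (?r ?l) i [] 0 out"
          and st' = "\<lambda>i. store w 0 (?r (Suc i)) 0 (?r ?l) i [] 0 out"])
      fix i assume "i < length (?r ?l)"
      then show "run (if ?r ?l ! i then ?a' else ?a') (store w 0 (?r i) 0 (?r ?l) i [] 0 out) (8 * (L + 1))
        (store w 0 (?r (Suc i)) 0 (?r ?l) i [] 0 out)"
        using run_append_ones[of 1 "store w 0 (?r i) 0 (?r ?l) i [] 0 out" "?r i" 1 L] assms(2)
        by (simp add: replicate_append_same del: append_ones.simps)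
    qed auto
    then show ?thesis by simp
  qed
  have 4: "run (erase 2) (store w 0 (?r ?l) 0 (?r ?l) 0 [] 0 out) (6 * ?l + 4)
      (store w 0 (?r ?l) 0 [] 0 [] 0 out)"
    using run_erase[of 2 "store w 0 (?r ?l) 0 (?r ?l) 0 [] 0 out" "?r ?l"] by simp
  have "run (times_input c) (store w 0 (?r m) 0 [] 0 [] 0 out)
      ((m * (?B + 8) + 4) + ((6 * m + 4) + ((?l * (8 * (L + 1) + 8) + 4) + (6 * ?l + 4))))
      (store w 0 (?r ?l) 0 [] 0 [] 0 out)"
    unfolding times_input_def Let_def by (intro run_Seq[OF 1] run_Seq[OF 2] run_Seq[OF 3] 4)
  moreover have "(m * (?B + 8) + 4) + ((6 * m + 4) + ((?l * (8 * (L + 1) + 8) + 4) + (6 * ?l + 4)))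
    \<le> (L * ((L * (8 * (L + 1)) + (L * (8 * (L + 1) + 8) + 4)) + 8) + 4) +
      ((6 * L + 4) + ((L * (8 * (L + 1) + 8) + 4) + (6 * L + 4)))"
    using assms by (intro add_le_mono mult_le_mono order_refl)
  moreover have "\<dots> \<le> 100 * (L + 1) ^ 3"
    by (simp add: power3_eq_cube algebra_simps)
  ultimately show ?thesis by (meson le_trans run_mono)
qed

fun power_input :: "nat \<Rightarrow> nat \<Rightarrow> prog" where
  "power_input c 0 = append_ones 1 1"
| "power_input c (Suc d) = Seq (power_input c d) (times_input c)"

lemma run_power_input:
  assumes "c \<ge> 1" "(length w + c) ^ d \<le> L" "length w \<le> L" "c \<le> L"
  shows "run (power_input c d) (store w 0 [] 0 [] 0 [] 0 []) (100 * (d + 1) * (L + 1) ^ 3)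
    (store w 0 (replicate ((length w + c) ^ d) True) 0 [] 0 [] 0 [])"
  using assms(2)
proof (induction d)
  case 0
  have "run (append_ones 1 1) (store w 0 [] 0 [] 0 [] 0 []) (8 * (L + 1))
    (store w 0 [True] 0 [] 0 [] 0 [])"
    using run_append_ones[of 1 "store w 0 [] 0 [] 0 [] 0 []" "[]" 1 L] assms
    by (simp del: append_ones.simps)
  then show ?case by (simp del: append_ones.simps) (erule run_mono, simp add: power3_eq_cube)
next
  case (Suc d)
  have "(length w + c) ^ d \<le> (length w + c) ^ Suc d" using assms(1) by simp
  then have le: "(length w + c) ^ d \<le> L" using Suc.prems by linarith
  have "run (times_input c) (store w 0 (replicate ((length w + c) ^ d) True) 0 [] 0 [] 0 [])
    (100 * (L + 1) ^ 3) (store w 0 (replicate ((length w + c) ^ Suc d) True) 0 [] 0 [] 0 [])"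
    using run_times_input[of "(length w + c) ^ d" L w c "[]"] le Suc.prems assms
    by (simp add: mult.commute)
  from run_Seq[OF Suc.IH[OF le] this] show ?case by (simp add: algebra_simps)
qed

lemma admissible_foldr_put: "admissible 5 (foldr (\<lambda>b. Seq (put b)) s p) \<longleftrightarrow> admissible 5 p"
  by (induction s) (auto simp: put_def bit_symbol_def)

lemma admissible_append_ones: "j < 5 \<Longrightarrow> admissible 5 (append_ones j n)"
  by (induction n) (auto simp: append_bit_def to_end_def to_start_def bit_symbol_def)

lemma admissible_for_each:
  "admissible 5 (for_each j p q) \<longleftrightarrow> j < 5 \<and> admissible 5 p \<and> admissible 5 q"
  by (auto simp: for_each_def to_start_def)

lemma admissible_erase: "j < 5 \<Longrightarrow> admissible 5 (erase j)"
  by (auto simp: erase_def to_end_def)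

lemma admissible_emit: "admissible 5 (emit xs)"
  by (induction xs rule: emit.induct)
    (auto simp: admissible_foldr_put admissible_for_each, auto simp: put_def bit_symbol_def)

lemma admissible_cmds: "admissible 5 (cmds_prog xs)"
proof (induction xs)
  case (Cons x xs)
  then show ?case by (cases x)
    (auto simp: admissible_emit admissible_append_ones admissible_for_each admissible_erase
      simp del: emit.simps append_ones.simps)
qed simp

lemma admissible_power_input: "admissible 5 (power_input c d)"
  by (induction d) (auto simp: times_input_def Let_def admissible_append_ones admissible_for_each
      admissible_erase simp del: append_ones.simps)

theorem polytime_computable_cmds:
  assumes "c \<ge> 1"
  shows "polytime_computable (\<lambda>w. concat (map (cmd_output w ((length w + c) ^ d)) xs))"
proof -
  define P :: "nat poly" where "P = 7 * ([:c, 1:] ^ d + [:c, 1:]) + 1"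
  define Q where "Q = of_nat (100 * (d + 1)) * P ^ 3 + of_nat (sum_list (map cmd_cost xs)) * P\<^sup>2"
  have "computes_in_time (machine 5 (compile 0 (Seq (power_input c d) (cmds_prog xs))))
    (\<lambda>w. concat (map (cmd_output w ((length w + c) ^ d)) xs)) (poly Q)"
  proof (rule computes_in_time_if_run)
    fix w :: "bool list"
    let ?m = "(length w + c) ^ d"
    \<comment> \<open>\<open>L\<close> dominates the counter, the input, \<open>c\<close>, and the
      index word, which grows to seven symbols per round; \<open>P\<close> is the polynomial with
      value \<open>L + 1\<close>.\<close>
    define L where "L = 7 * (?m + (length w + c))"
    have P: "poly P (length w) = L + 1" by (simp add: P_def L_def ac_simps)
    have "run (power_input c d) (store w 0 [] 0 [] 0 [] 0 []) (100 * (d + 1) * (L + 1) ^ 3)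
      (store w 0 (replicate ?m True) 0 [] 0 [] 0 [])"
      using assms by (intro run_power_input) (auto simp: L_def)
    moreover have "run (cmds_prog xs) (store w 0 (replicate ?m True) 0 [] 0 [] 0 [])
      (sum_list (map cmd_cost xs) * (L + 1)\<^sup>2)
      (store w 0 (replicate ?m True) 0 [] 0 [] 0 ([] @ concat (map (cmd_output w ?m) xs)))"
      by (rule run_cmds) (auto simp: L_def)
    ultimately have "run (Seq (power_input c d) (cmds_prog xs)) (store w 0 [] 0 [] 0 [] 0 [])
      (poly Q (length w))
      (store w 0 (replicate ?m True) 0 [] 0 [] 0 ([] @ concat (map (cmd_output w ?m) xs)))"
      unfolding Q_def by (simp add: P of_nat_poly) (rule run_Seq, simp_all)
    moreover have "store w 0 [] 0 [] 0 [] 0 [] = (word_tape w, 0) # replicate (5 - 1) (\<lambda>_. 0, 0)"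
      by (simp add: store_def word_at_def word_tape_def numeral_eq_Suc fun_eq_iff)
    ultimately show "\<exists>ts. run (Seq (power_input c d) (cmds_prog xs))
        ((word_tape w, 0) # replicate (5 - 1) (\<lambda>_. 0, 0)) (poly Q (length w)) ts \<and>
      fst (last ts) = word_tape (concat (map (cmd_output w ?m) xs))"
      by (intro exI[of _ "store w 0 (replicate ?m True) 0 [] 0 [] 0 ([] @ concat (map (cmd_output w ?m) xs))"])
        (simp add: store_def word_at_def)
  qed (auto simp: admissible_power_input admissible_cmds)
  then show ?thesis unfolding polytime_computable_def by blast
qed

section \<open>Monadic formulas\<close>

definition atom :: "nat \<Rightarrow> nat \<Rightarrow> ucv" where
  "atom R x = At (View 0 [] [(R, [0])]) x"

lemma sat_atom [simp]: "sat D I s (atom R x) \<longleftrightarrow> [s x] \<in> I R"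
  by (auto simp: atom_def intro!: exI[of _ "s(0 := s x)"])

lemma fv_atom [simp]: "fv (atom R x) = {x}"
  by (simp add: atom_def)

lemma encode_atom:
  "encode (atom R x) = [False, False, False, False, True] @ enc_nat R @ [True, False, False, False] @ enc_nat x"
  by (simp add: atom_def)

fun monadic :: "ucv \<Rightarrow> bool" where
  "monadic (At V x) \<longleftrightarrow> (\<exists>R. V = View 0 [] [(R, [0])])"
| "monadic (Neg \<phi>) \<longleftrightarrow> monadic \<phi>"
| "monadic (And \<phi> \<psi>) \<longleftrightarrow> monadic \<phi> \<and> monadic \<psi>"
| "monadic (Ex x \<phi>) \<longleftrightarrow> monadic \<phi>"

lemma monadic_atom [simp]: "monadic (atom R x)"
  by (simp add: atom_def)

definition unary_vocabulary :: "nat set \<Rightarrow> vocabulary" where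
  "unary_vocabulary F = (\<lambda>R. if R \<in> F then Some 1 else None)"

definition unary_views :: "nat set \<Rightarrow> view set" where
  "unary_views F = (\<lambda>R. View 0 [] [(R, [0])]) ` F"

lemma UCV_mono:
  assumes "\<phi> \<in> UCV (unary_vocabulary F) (unary_views F)" "F \<subseteq> G"
  shows "\<phi> \<in> UCV (unary_vocabulary G) (unary_views G)"
  using assms(1)
proof induction
  case (1 V x)
  then obtain R where "V = View 0 [] [(R, [0])]" "R \<in> G"
    using assms(2) by (auto simp: unary_views_def)
  then show ?case by (intro UCV.intros(1)) (auto simp: unary_vocabulary_def unary_views_def)
qed (simp_all add: UCV.intros)

text \<open>The symbols of the printed formula are indexed by bits and input positions, so its
  vocabulary depends on the input; it is collected from the atoms, joining the sets of both
  conjuncts of an \<open>And\<close> by \<open>UCV_mono\<close>.\<close>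

lemma UCV_if_monadic:
  "monadic \<phi> \<Longrightarrow> \<exists>F. finite F \<and> \<phi> \<in> UCV (unary_vocabulary F) (unary_views F)"
proof (induction \<phi>)
  case (At V x)
  then obtain R where "V = View 0 [] [(R, [0])]" by auto
  then have "V \<in> unary_views {R}" "is_view (unary_vocabulary {R}) V"
    by (simp_all add: unary_vocabulary_def unary_views_def)
  then have "At V x \<in> UCV (unary_vocabulary {R}) (unary_views {R})"
    by (rule UCV.intros(1))
  then show ?case by (intro exI[of _ "{R}"]) simp
next
  case (And \<phi> \<psi>)
  then obtain F G where "finite F" "\<phi> \<in> UCV (unary_vocabulary F) (unary_views F)"
    "finite G" "\<psi> \<in> UCV (unary_vocabulary G) (unary_views G)" by auto
  then have "And \<phi> \<psi> \<in> UCV (unary_vocabulary (F \<union> G)) (unary_views (F \<union> G))"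
    by (intro UCV.intros(3)) (erule UCV_mono, simp)+
  then show ?case using \<open>finite F\<close> \<open>finite G\<close> by blast
qed (use UCV.intros in \<open>simp, metis\<close>)+

text \<open>In a template, the flag of an atom tells whether its relation symbol is shifted by
  seven times the current loop index.\<close>

datatype template = TAtom bool nat nat | TNeg template | TAnd template template

fun inst :: "nat \<Rightarrow> template \<Rightarrow> ucv" where
  "inst i (TAtom r R x) = atom (if r then 7 * i + R else R) x"
| "inst i (TNeg t) = Neg (inst i t)"
| "inst i (TAnd t u) = And (inst i t) (inst i u)"

fun items :: "template \<Rightarrow> item list" where
  "items (TAtom r R x) =
     [Fixed [False, False, False, False, True]] @ (if r then [Index] else []) @
     [Fixed (enc_nat R @ [True, False, False, False] @ enc_nat x)]"
| "items (TNeg t) = Fixed [False, True] # items t"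
| "items (TAnd t u) = Fixed [True, False] # items t @ items u"

fun vars :: "template \<Rightarrow> nat set" where
  "vars (TAtom r R x) = {x}"
| "vars (TNeg t) = vars t"
| "vars (TAnd t u) = vars t \<union> vars u"

lemma enc_nat_add: "enc_nat (m + n) = replicate m True @ enc_nat n"
  by (induction m) auto

lemma render_items: "render (ones i) (items t) = encode (inst i t)"
  by (induction t) (auto simp: encode_atom enc_nat_add ones_def)

lemma fv_inst: "fv (inst i t) = vars t"
  by (induction t) auto

lemma monadic_inst: "monadic (inst i t)"
  by (induction t) auto

section \<open>Formulas with loops over address bits and input positions\<close>

datatype scheme = Leaf template | SNeg scheme | SAnd scheme scheme | SEx nat scheme
  | ChainN template template scheme | ChainW template template template scheme

fun formula :: "bool list \<Rightarrow> nat \<Rightarrow> scheme \<Rightarrow> ucv" where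
  "formula w m (Leaf t) = inst 0 t"
| "formula w m (SNeg f) = Neg (formula w m f)"
| "formula w m (SAnd f g) = And (formula w m f) (formula w m g)"
| "formula w m (SEx x f) = Ex x (formula w m f)"
| "formula w m (ChainN t u f) =
     foldr And (map (\<lambda>i. inst i t) [0..<m]) (And (inst m u) (formula w m f))"
| "formula w m (ChainW t t' u f) =
     foldr And (map (\<lambda>i. inst i (if w ! i then t' else t)) [0..<length w])
       (And (inst (length w) u) (formula w m f))"

fun cmds :: "scheme \<Rightarrow> cmd list" where
  "cmds (Leaf t) = [Emit (encode (inst 0 t))]"
| "cmds (SNeg f) = Emit [False, True] # cmds f"
| "cmds (SAnd f g) = Emit [True, False] # cmds f @ cmds g"
| "cmds (SEx x f) = Emit ([True, True] @ enc_nat x) # cmds f"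
| "cmds (ChainN t u f) =
     LoopN (Fixed [True, False] # items t) (Fixed [True, False] # items u) # cmds f"
| "cmds (ChainW t t' u f) =
     LoopW (Fixed [True, False] # items t) (Fixed [True, False] # items t')
       (Fixed [True, False] # items u) # cmds f"

fun scheme_fv :: "scheme \<Rightarrow> nat set" where
  "scheme_fv (Leaf t) = vars t"
| "scheme_fv (SNeg f) = scheme_fv f"
| "scheme_fv (SAnd f g) = scheme_fv f \<union> scheme_fv g"
| "scheme_fv (SEx x f) = scheme_fv f - {x}"
| "scheme_fv (ChainN t u f) = vars t \<union> vars u \<union> scheme_fv f"
| "scheme_fv (ChainW t t' u f) = vars t \<union> vars t' \<union> vars u \<union> scheme_fv f"

text \<open>In prefix notation a right-nested conjunction is the concatenation of its conjuncts,
  each preceded by the code of \<open>And\<close>. Nothing has to be closed at the end, so a loop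
  can print it.\<close>

lemma encode_foldr_And:
  "encode (foldr And \<phi>s \<psi>) = concat (map (\<lambda>\<phi>. [True, False] @ encode \<phi>) \<phi>s) @ encode \<psi>"
  by (induction \<phi>s) auto

lemma sat_foldr_And:
  "sat D I s (foldr And \<phi>s \<psi>) \<longleftrightarrow> (\<forall>\<phi> \<in> set \<phi>s. sat D I s \<phi>) \<and> sat D I s \<psi>"
  by (induction \<phi>s) auto

lemma fv_foldr_And: "fv (foldr And \<phi>s \<psi>) = (\<Union>\<phi> \<in> set \<phi>s. fv \<phi>) \<union> fv \<psi>"
  by (induction \<phi>s) auto

lemma monadic_foldr_And:
  "monadic (foldr And \<phi>s \<psi>) \<longleftrightarrow> (\<forall>\<phi> \<in> set \<phi>s. monadic \<phi>) \<and> monadic \<psi>"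
  by (induction \<phi>s) auto

lemma output_cmds: "concat (map (cmd_output w m) (cmds f)) = encode (formula w m f)"
  by (induction f) (auto simp: encode_foldr_And render_items comp_def intro!: arg_cong[of _ _ concat])

lemma fv_formula: "fv (formula w m f) \<subseteq> scheme_fv f"
  by (induction f) (auto simp: fv_foldr_And fv_inst split: if_splits)

lemma monadic_formula: "monadic (formula w m f)"
  by (induction f) (auto simp: monadic_foldr_And monadic_inst)

lemma sat_ChainN:
  "sat D I s (formula w m (ChainN t u f)) \<longleftrightarrow>
    (\<forall>i < m. sat D I s (inst i t)) \<and> sat D I s (inst m u) \<and> sat D I s (formula w m f)"
  by (auto simp: sat_foldr_And)

lemma sat_ChainW:
  "sat D I s (formula w m (ChainW t t' u f)) \<longleftrightarrow>
    (\<forall>i < length w. sat D I s (inst i (if w ! i then t' else t))) \<and>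
    sat D I s (inst (length w) u) \<and> sat D I s (formula w m f)"
  by (auto simp: sat_foldr_And)

declare formula.simps(5,6) [simp del]

text \<open>The syntax has no truth constant, so a tautology in variable 0 takes its place.\<close>

definition ttrue :: template where
  "ttrue = TNeg (TAnd (TAtom False 0 0) (TNeg (TAtom False 0 0)))"

definition timp :: "template \<Rightarrow> template \<Rightarrow> template" where
  "timp t u = TNeg (TAnd t (TNeg u))"

definition tiff :: "template \<Rightarrow> template \<Rightarrow> template" where
  "tiff t u = TAnd (timp t u) (timp u t)"

definition tconj :: "template list \<Rightarrow> template" where
  "tconj ts = foldr TAnd ts ttrue"

lemma sat_connectives [simp]:
  "sat D I s (inst i ttrue)"
  "sat D I s (inst i (timp t u)) \<longleftrightarrow> (sat D I s (inst i t) \<longrightarrow> sat D I s (inst i u))"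
  "sat D I s (inst i (tiff t u)) \<longleftrightarrow> (sat D I s (inst i t) \<longleftrightarrow> sat D I s (inst i u))"
  by (auto simp: ttrue_def timp_def tiff_def)

lemma sat_tconj [simp]: "sat D I s (inst i (tconj ts)) \<longleftrightarrow> (\<forall>t \<in> set ts. sat D I s (inst i t))"
  by (induction ts) (auto simp: tconj_def)

lemma vars_connectives [simp]:
  "vars ttrue = {0}" "vars (timp t u) = vars t \<union> vars u" "vars (tiff t u) = vars t \<union> vars u"
  by (auto simp: ttrue_def timp_def tiff_def)

lemma vars_tconj [simp]: "vars (tconj ts) = insert 0 (\<Union>t \<in> set ts. vars t)"
  by (induction ts) (auto simp: tconj_def)

section \<open>Binary numbers of m bits and their successors\<close>

fun val :: "nat \<Rightarrow> (nat \<Rightarrow> bool) \<Rightarrow> nat" where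
  "val 0 b = 0"
| "val (Suc m) b = val m b + of_bool (b m) * 2 ^ m"

lemma val_less: "val m b < 2 ^ m"
  by (induction m) auto

lemma val_bit: "val m (bit t) = take_bit m t"
  by (induction m) (auto simp: take_bit_Suc_from_most)

lemma val_eq_iff: "val m b = val m b' \<longleftrightarrow> (\<forall>k < m. b k = b' k)"
proof (induction m)
  case (Suc m)
  have "val (Suc m) b = val (Suc m) b' \<longleftrightarrow> val m b = val m b' \<and> b m = b' m"
    using val_less[of m b] val_less[of m b'] by (auto simp: of_bool_def)
  then show ?case using Suc by (auto simp: less_Suc_eq)
qed simp

lemma val_eq_0_iff: "val m b = 0 \<longleftrightarrow> (\<forall>k < m. \<not> b k)"
  by (induction m) (auto simp: less_Suc_eq)

lemma val_eq_max_iff: "val m b = 2 ^ m - 1 \<longleftrightarrow> (\<forall>k < m. b k)"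
proof (induction m)
  case (Suc m)
  have "val (Suc m) b = 2 ^ Suc m - 1 \<longleftrightarrow> val m b = 2 ^ m - 1 \<and> b m"
    using val_less[of m b] by (auto simp: of_bool_def)
  then show ?case using Suc by (auto simp: less_Suc_eq)
qed simp

text \<open>Incrementing flips a bit exactly if all lower bits are 1. Keeping the overflow as a
  summand of weight \<open>2 ^ m\<close> makes the equation exact and hence inductive.\<close>

lemma val_succ:
  "val m (\<lambda>k. b k \<noteq> (\<forall>i < k. b i)) + of_bool (\<forall>i < m. b i) * 2 ^ m = val m b + 1"
proof (induction m)
  case (Suc m)
  have "(\<forall>i < Suc m. b i) \<longleftrightarrow> (\<forall>i < m. b i) \<and> b m" by (auto simp: less_Suc_eq)
  then show ?case using Suc by (auto simp: of_bool_def split: if_splits)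
qed simp

lemma val_succ_iff:
  "(\<forall>k < m. b' k \<longleftrightarrow> (b k \<noteq> (\<forall>i < k. b i))) \<longleftrightarrow> val m b' = (val m b + 1) mod 2 ^ m"
proof -
  let ?b = "\<lambda>k. b k \<noteq> (\<forall>i < k. b i)"
  have "val m ?b = (val m b + 1) mod 2 ^ m"
    unfolding val_succ[symmetric] mod_mult_self1 using val_less by (rule mod_less[symmetric])
  then show ?thesis using val_eq_iff[of m b' ?b] by simp
qed

text \<open>In binary, \<open>2 ^ (m - 1) - 1\<close> is a 0 followed by ones. Hence the top bit and
  the conjunction of the others, which is the carry into the top bit, decide the comparison with the
  middle of the range.\<close>

lemma val_top_iff:
  assumes "0 < m"
  shows "b (m - 1) \<longleftrightarrow> 2 ^ (m - 1) \<le> val m b"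
    "(\<forall>k < m - 1. b k) \<and> \<not> b (m - 1) \<longleftrightarrow> val m b = 2 ^ (m - 1) - 1"
    "\<not> (\<forall>k < m - 1. b k) \<and> \<not> b (m - 1) \<longleftrightarrow> val m b < 2 ^ (m - 1) - 1"
proof -
  obtain n where m: "m = Suc n" using assms by (cases m) auto
  obtain q where q: "(2::nat) ^ n = Suc q" using not0_implies_Suc[of "2 ^ n"] by auto
  show "b (m - 1) \<longleftrightarrow> 2 ^ (m - 1) \<le> val m b"
    using val_less[of n b] by (auto simp: m)
  show "(\<forall>k < m - 1. b k) \<and> \<not> b (m - 1) \<longleftrightarrow> val m b = 2 ^ (m - 1) - 1"
    using val_less[of n b] val_eq_max_iff[of n b] q by (auto simp: m of_bool_def split: if_splits)
  show "\<not> (\<forall>k < m - 1. b k) \<and> \<not> b (m - 1) \<longleftrightarrow> val m b < 2 ^ (m - 1) - 1"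
    using val_less[of n b] val_eq_max_iff[of n b] by (auto simp: m of_bool_def split: if_splits)
qed

section \<open>Tableaux of runs\<close>

type_synonym transition = "(nat \<times> nat list) \<times> (nat \<times> (nat \<times> move) list)"

definition source :: "transition \<Rightarrow> nat" where "source \<tau> = fst (fst \<tau>)"
definition reads :: "transition \<Rightarrow> nat list" where "reads \<tau> = snd (fst \<tau>)"
definition target :: "transition \<Rightarrow> nat" where "target \<tau> = fst (snd \<tau>)"
definition actions :: "transition \<Rightarrow> (nat \<times> move) list" where "actions \<tau> = snd (snd \<tau>)"

text \<open>The list \<open>ls\<close> numbers the transitions, so that each gets its own predicate.
  No transition reads a symbol of size \<open>s\<close> or more, although such symbols may be
  written; claims about symbols below \<open>s\<close> are all that a run needs.\<close>

locale bounded_machine =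
  fixes M :: tm and ls :: "transition list" and s :: nat
  assumes wf: "tm_wf M"
    and ls: "set ls = delta M"
    and reads_less: "l < length ls \<Longrightarrow> j < tapes M \<Longrightarrow> reads (ls ! l) ! j < s"
begin

lemma lengths:
  assumes "l < length ls"
  shows "length (reads (ls ! l)) = tapes M" "length (actions (ls ! l)) = tapes M"
proof -
  obtain q rs q' as where \<tau>: "ls ! l = ((q, rs), (q', as))" by (metis surj_pair)
  then have "((q, rs), (q', as)) \<in> delta M" using assms ls nth_mem by metis
  then show "length (reads (ls ! l)) = tapes M" "length (actions (ls ! l)) = tapes M"
    using wf \<tau> by (auto simp: tm_wf_def reads_def actions_def)
qed

lemma step_iff:
  "step M c c' \<longleftrightarrow> (\<exists>l < length ls. fst c = source (ls ! l) \<and> map scanned (snd c) = reads (ls ! l) \<and>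
     c' = (target (ls ! l), map2 act (actions (ls ! l)) (snd c)))"
proof
  assume "step M c c'"
  then obtain q as where "((fst c, map scanned (snd c)), (q, as)) \<in> set ls"
    "c' = (q, map2 act as (snd c))"
    by (auto simp: step_def ls)
  then show "\<exists>l < length ls. fst c = source (ls ! l) \<and> map scanned (snd c) = reads (ls ! l) \<and>
     c' = (target (ls ! l), map2 act (actions (ls ! l)) (snd c))"
    unfolding in_set_conv_nth source_def reads_def target_def actions_def by (metis fst_conv snd_conv)
next
  assume "\<exists>l < length ls. fst c = source (ls ! l) \<and> map scanned (snd c) = reads (ls ! l) \<and>
     c' = (target (ls ! l), map2 act (actions (ls ! l)) (snd c))"
  then obtain l where "l < length ls" "fst c = source (ls ! l)" "map scanned (snd c) = reads (ls ! l)"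
     "c' = (target (ls ! l), map2 act (actions (ls ! l)) (snd c))" by blast
  moreover from this have "ls ! l \<in> delta M" using ls nth_mem by blast
  moreover have "ls ! l = ((source (ls ! l), reads (ls ! l)), (target (ls ! l), actions (ls ! l)))"
    by (simp add: source_def reads_def target_def actions_def)
  ultimately show "step M c c'" unfolding step_def by metis
qed

end

text \<open>Every element \<open>x\<close> of \<open>D\<close> describes one cell of every tape at time \<open>T x\<close>.  Positions are
  relative to the heads, which always scan the cells at position \<open>2 ^ (m - 1) - 1\<close>.  The predicate
  \<open>lab l\<close> says that the transition number \<open>l\<close> is taken at time \<open>T x\<close>, and \<open>acc\<close> that the machine
  has already stopped.  No cell is required to carry a symbol, except where a symbol is read; the
  axioms only exclude wrong symbols.\<close>

locale tableau = bounded_machine M ls s for M ls s +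
  fixes w :: "bool list" and m :: nat and D :: "'a set" and T P :: "'a \<Rightarrow> nat"
    and acc :: "'a \<Rightarrow> bool" and lab :: "nat \<Rightarrow> 'a \<Rightarrow> bool" and sym :: "nat \<Rightarrow> nat \<Rightarrow> 'a \<Rightarrow> bool"
    and pin :: "nat \<Rightarrow> 'a \<Rightarrow> bool"
  assumes late: "x \<in> D \<Longrightarrow> 2 ^ (m - 1) \<le> T x \<Longrightarrow> acc x"
    and center_pin: "x \<in> D \<Longrightarrow> P x = 2 ^ (m - 1) - 1 \<Longrightarrow> pin 0 x"
    and center_reads: "x \<in> D \<Longrightarrow> P x = 2 ^ (m - 1) - 1 \<Longrightarrow> l < length ls \<Longrightarrow> j < tapes M \<Longrightarrow>
      lab l x \<Longrightarrow> sym j (reads (ls ! l) ! j) x"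
    and labelled: "x \<in> D \<Longrightarrow> acc x \<or> (\<exists>l < length ls. lab l x)"
    and origin: "\<exists>x \<in> D. T x = 0 \<and> P x = 0"
    and next_position: "x \<in> D \<Longrightarrow> \<exists>y \<in> D. T x = T y \<and> P y = (P x + 1) mod 2 ^ m"
    and next_time: "x \<in> D \<Longrightarrow> \<exists>y \<in> D. T y = (T x + 1) mod 2 ^ m \<and> P x = P y"
    and broadcast_acc: "x \<in> D \<Longrightarrow> y \<in> D \<Longrightarrow> T x = T y \<Longrightarrow> acc x \<Longrightarrow> acc y"
    and broadcast_lab: "x \<in> D \<Longrightarrow> y \<in> D \<Longrightarrow> T x = T y \<Longrightarrow> l < length ls \<Longrightarrow> lab l x \<Longrightarrow> lab l y"
    and next_lab: "x \<in> D \<Longrightarrow> y \<in> D \<Longrightarrow> T y = T x + 1 \<Longrightarrow> l < length ls \<Longrightarrow> l' < length ls \<Longrightarrow>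
      lab l x \<Longrightarrow> lab l' y \<Longrightarrow> target (ls ! l) = source (ls ! l')"
    and next_acc: "x \<in> D \<Longrightarrow> y \<in> D \<Longrightarrow> T y = T x + 1 \<Longrightarrow> l < length ls \<Longrightarrow>
      lab l x \<Longrightarrow> acc y \<Longrightarrow> target (ls ! l) = accept M"
    and update: "x \<in> D \<Longrightarrow> y \<in> D \<Longrightarrow> T y = T x + 1 \<Longrightarrow> l < length ls \<Longrightarrow> j < tapes M \<Longrightarrow> a < s \<Longrightarrow>
      int (P x) = shift (snd (actions (ls ! l) ! j)) (int (P y)) \<Longrightarrow> lab l x \<Longrightarrow> sym j a y \<Longrightarrow>
      if P x = 2 ^ (m - 1) - 1 then a = fst (actions (ls ! l) ! j) else sym j a x"
    and next_pin: "x \<in> D \<Longrightarrow> y \<in> D \<Longrightarrow> P y = P x + 1 \<Longrightarrow> i < length w \<Longrightarrow> pin i x \<Longrightarrow> pin (Suc i) y"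
    and last_pin: "x \<in> D \<Longrightarrow> y \<in> D \<Longrightarrow> P y = P x + 1 \<Longrightarrow> pin (length w) x \<Longrightarrow> pin (length w) y"
    and init_left: "x \<in> D \<Longrightarrow> T x = 0 \<Longrightarrow> P x < 2 ^ (m - 1) - 1 \<Longrightarrow> a < s \<Longrightarrow> sym 0 a x \<Longrightarrow> a = 0"
    and init_blank: "x \<in> D \<Longrightarrow> T x = 0 \<Longrightarrow> 0 < j \<Longrightarrow> j < tapes M \<Longrightarrow> a < s \<Longrightarrow> sym j a x \<Longrightarrow> a = 0"
    and init_lab: "x \<in> D \<Longrightarrow> T x = 0 \<Longrightarrow> l < length ls \<Longrightarrow> lab l x \<Longrightarrow> source (ls ! l) = start M"
    and init_acc: "x \<in> D \<Longrightarrow> T x = 0 \<Longrightarrow> acc x \<Longrightarrow> start M = accept M"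
    and init_word: "x \<in> D \<Longrightarrow> T x = 0 \<Longrightarrow> i < length w \<Longrightarrow> a < s \<Longrightarrow> pin i x \<Longrightarrow> sym 0 a x \<Longrightarrow>
      a = (if w ! i then 2 else 1)"
    and init_right: "x \<in> D \<Longrightarrow> T x = 0 \<Longrightarrow> a < s \<Longrightarrow> pin (length w) x \<Longrightarrow> sym 0 a x \<Longrightarrow> a = 0"
begin

section \<open>From a tableau to an accepting run\<close>

lemma element_exists:
  assumes "t < 2 ^ m" "p < 2 ^ m"
  obtains x where "x \<in> D" "T x = t" "P x = p"
proof -
  have row: "\<exists>x \<in> D. T x = 0 \<and> P x = q" if "q < 2 ^ m" for q
    using that
  proof (induction q)
    case 0
    then show ?case using origin by blast
  next
    case (Suc q)
    then obtain x where "x \<in> D" "T x = 0" "P x = q" by auto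
    then show ?case using next_position[of x] Suc.prems by auto
  qed
  have "\<exists>x \<in> D. T x = t \<and> P x = p"
    using assms(1)
  proof (induction t)
    case 0
    then show ?case using row[OF assms(2)] by blast
  next
    case (Suc t)
    then obtain x where "x \<in> D" "T x = t" "P x = p" by auto
    then show ?case using next_time[of x] Suc.prems by auto
  qed
  then show ?thesis using that by blast
qed

definition center :: nat where "center = 2 ^ (m - 1) - 1"

lemma center_bounds:
  assumes "0 < m"
  shows "Suc center = 2 ^ (m - 1)" "2 * center + 2 = 2 ^ m"
proof -
  have "(1::nat) \<le> 2 ^ (m - 1)" "(2::nat) ^ m = 2 * 2 ^ (m - 1)"
    using assms power_Suc[of "2::nat" "m - 1"] by simp_all
  then show "Suc center = 2 ^ (m - 1)" "2 * center + 2 = 2 ^ m"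
    unfolding center_def by linarith+
qed

text \<open>Pins are passed between any elements with successive positions, whatever their times, so
  the left neighbour can be taken from row 0. The pin \<open>length w\<close> reproduces itself and
  thus marks all blanks to the right of the input.\<close>

lemma pin_right:
  assumes "x \<in> D" "P x = center + i" "P x < 2 ^ m"
  shows "pin (min i (length w)) x"
  using assms
proof (induction i arbitrary: x)
  case 0
  then show ?case using center_pin[of x] by (simp add: center_def)
next
  case (Suc i)
  obtain y where y: "y \<in> D" "P y = center + i"
    using element_exists[of 0 "center + i"] Suc.prems by auto
  then have "pin (min i (length w)) y" using Suc by auto
  then show ?case using next_pin[of y x i] last_pin[of y x] y Suc.prems
    by (cases "i < length w") (auto simp: min_def split: if_splits)
qed

definition cell :: "config \<Rightarrow> nat \<Rightarrow> int \<Rightarrow> nat" where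
  "cell c j i = fst (snd c ! j) (snd (snd c ! j) + i)"

text \<open>The tableau is only reliable in a window around the heads that shrinks by one in every
  step: nothing is known beyond its left and right borders.\<close>

definition consistent :: "nat \<Rightarrow> config \<Rightarrow> bool" where
  "consistent t c \<longleftrightarrow> (step M ^^ t) (init M w) c \<and> length (snd c) = tapes M \<and>
     (\<forall>x \<in> D. T x = t \<longrightarrow>
        (\<forall>j < tapes M. \<forall>a < s. sym j a x \<longrightarrow> \<bar>int (P x) - int center\<bar> + int t \<le> int center \<longrightarrow>
           a = cell c j (int (P x) - int center)) \<and>
        (\<forall>l < length ls. lab l x \<longrightarrow> fst c = source (ls ! l)) \<and> (acc x \<longrightarrow> fst c = accept M))"

text \<open>At time 0 the window contains every position except \<open>2 ^ m - 1\<close>. On the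
  input tape \<open>init_left\<close> settles the cells before the head, and the pins settle the
  rest.\<close>

lemma consistent_init:
  assumes "0 < m"
  shows "consistent 0 (init M w)"
proof -
  have k: "tapes M \<ge> 1" using wf by (simp add: tm_wf_def)
  have "a = cell (init M w) j (int (P x) - int center)"
    if x: "x \<in> D" "T x = 0" "j < tapes M" "a < s" "sym j a x"
      "\<bar>int (P x) - int center\<bar> \<le> int center" for x j a
  proof (cases "j = 0")
    case False
    then have "a = 0" using init_blank x by blast
    then show ?thesis using False x(3) by (simp add: cell_def init_def nth_Cons')
  next
    case True
    have c: "cell (init M w) 0 i = word_tape w i" for i
      by (simp add: cell_def init_def)
    show ?thesis
    proof (cases "P x < center")
      case True
      then have "a = 0" using init_left[folded center_def, of x a] x \<open>j = 0\<close> by blast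
      then show ?thesis using True \<open>j = 0\<close> by (simp add: c word_tape_def)
    next
      case False
      then obtain i where i: "P x = center + i" by (metis le_Suc_ex not_less)
      have "P x \<le> 2 * center" using x(6) by linarith
      then have "pin (min i (length w)) x" using pin_right[OF x(1) i] center_bounds(2)[OF assms] by linarith
      then show ?thesis using init_word[of x i a] init_right[of x a] x \<open>j = 0\<close>
        by (auto simp: c i word_tape_def min_def split: if_splits)
    qed
  qed
  then show ?thesis using k init_lab init_acc
    by (auto simp: consistent_def) (simp_all add: init_def)
qed

text \<open>A label at time \<open>t\<close> is broadcast to an element \<open>z\<close> at the
  centre, where it forces claims about the scanned symbols. As \<open>t \<le> center\<close>, the
  centre is still in the window, so these claims are true and the labelled transition is
  enabled.\<close>

lemma consistent_step:
  assumes "consistent t c" "t \<le> center" "0 < m" and x: "x \<in> D" "T x = t" "\<not> acc x"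
  shows "\<exists>c'. consistent (Suc t) c'"
proof -
  have len: "length (snd c) = tapes M" using assms(1) by (simp add: consistent_def)
  have lt: "center < 2 ^ m" using center_bounds(2)[OF assms(3)] by linarith
  obtain z where z: "z \<in> D" "T z = t" "P z = center"
    using element_exists[of t center] lt assms(2) by auto
  obtain l where l: "l < length ls" "lab l x" using labelled x by blast
  have lab: "lab l y" if "y \<in> D" "T y = t" for y
    using broadcast_lab[of x y l] that l x by simp
  let ?\<tau> = "ls ! l"
  let ?c' = "(target ?\<tau>, map2 act (actions ?\<tau>) (snd c))"
  have src: "fst c = source ?\<tau>" using assms(1) x l by (auto simp: consistent_def)
  have "map scanned (snd c) = reads ?\<tau>"
  proof (rule nth_equalityI)
    fix j assume "j < length (map scanned (snd c))"
    then have j: "j < tapes M" using len by simp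
    have "sym j (reads ?\<tau> ! j) z" using center_reads[folded center_def, of z l j] z l(1) j lab[of z] by simp
    then have "reads ?\<tau> ! j = cell c j 0"
      using assms(1,2) z j reads_less[OF l(1) j] by (fastforce simp: consistent_def)
    then show "map scanned (snd c) ! j = reads ?\<tau> ! j"
      using j len by (cases "snd c ! j") (simp add: cell_def)
  qed (use len lengths l in simp)
  then have step: "step M c ?c'" unfolding step_iff using src l(1) by blast
  have "consistent (Suc t) ?c'"
    unfolding consistent_def
  proof (intro conjI ballI impI allI)
    show "(step M ^^ Suc t) (init M w) ?c'"
      using assms(1) step by (auto simp: consistent_def)
    show "length (snd ?c') = tapes M" using len lengths(2)[OF l(1)] by simp
    fix y assume y: "y \<in> D" "T y = Suc t"
    show "fst ?c' = source (ls ! l')" if "l' < length ls" "lab l' y" for l'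
      using next_lab[of x y l l'] x y l that by simp
    show "fst ?c' = accept M" if "acc y"
      using next_acc[of x y l] x y l that by simp
    fix j a assume j: "j < tapes M" and a: "a < s" "sym j a y"
      and win: "\<bar>int (P y) - int center\<bar> + int (Suc t) \<le> int center"
    obtain b d where bd: "actions ?\<tau> ! j = (b, d)" by fastforce
    obtain g h where gh: "snd c ! j = (g, h)" by fastforce
    \<comment> \<open>The cell described by \<open>y\<close> had position \<open>p\<close> before
      the step. Since the window loses one cell at each side, \<open>p\<close> lies in the window of
      time \<open>t\<close>; in particular it is a valid address.\<close>
    define p where "p = nat (shift d (int (P y)))"
    have sh: "\<bar>shift d (int (P y)) - int (P y)\<bar> \<le> 1" by (cases d) auto
    have p: "int p = shift d (int (P y))" "\<bar>int p - int center\<bar> + int t \<le> int center"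
      using win sh unfolding p_def by linarith+
    then have "p < 2 ^ m"
      using center_bounds(2)[OF assms(3)] by linarith
    then obtain x' where x': "x' \<in> D" "T x' = t" "P x' = p"
      using element_exists[of t p] lt assms(2) by auto
    have upd: "if p = center then a = b else sym j a x'"
      using update[folded center_def, of x' y l j a] x' y l(1) j a bd p(1) lab[of x'] by simp
    \<comment> \<open>Both sides are the absolute position of the cell, computed from the head after
      and before the step.\<close>
    have e: "shift d h + (int (P y) - int center) = h + (int p - int center)"
      using p(1) by (cases d) simp_all
    have "cell ?c' j (int (P y) - int center) = (g(h := b)) (shift d h + (int (P y) - int center))"
      using j len lengths(2)[OF l(1)] by (simp add: cell_def bd gh)
    then have new: "cell ?c' j (int (P y) - int center) = (g(h := b)) (h + (int p - int center))"
      unfolding e .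
    show "a = cell ?c' j (int (P y) - int center)"
    proof (cases "p = center")
      case True
      then show ?thesis using upd new by simp
    next
      case False
      then have "a = cell c j (int p - int center)"
        using upd assms(1) x' j a(1) p(2) by (auto simp: consistent_def)
      then show ?thesis using new False by (simp add: cell_def gh)
    qed
  qed
  then show ?thesis by blast
qed

text \<open>If no run accepts, a consistent configuration excludes \<open>acc\<close> at its time.
  So a label holds, the run continues, and consistency reaches time \<open>2 ^ (m - 1)\<close>,
  where \<open>late\<close> demands \<open>acc\<close>.\<close>

theorem accepting_run:
  assumes "0 < m"
  shows "\<exists>c. (step M)\<^sup>*\<^sup>* (init M w) c \<and> fst c = accept M"
proof (rule ccontr)
  assume no: "\<not> ?thesis"
  have no_acc: "\<not> acc x" if "consistent t c" "x \<in> D" "T x = t" for t c x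
  proof
    assume "acc x"
    then have "(step M ^^ t) (init M w) c" "fst c = accept M"
      using that by (simp_all add: consistent_def)
    then show False using no relpowp_imp_rtranclp by metis
  qed
  have lt: "center < 2 ^ m" using center_bounds(2)[OF assms] by linarith
  have "\<exists>c. consistent t c" if "t \<le> 2 ^ (m - 1)" for t
    using that
  proof (induction t)
    case 0
    then show ?case using consistent_init assms by blast
  next
    case (Suc t)
    then obtain c where c: "consistent t c" by auto
    have t: "t \<le> center" using Suc.prems center_bounds(1)[OF assms] by linarith
    then obtain x where x: "x \<in> D" "T x = t"
      using element_exists[of t 0] lt by auto
    show ?case using consistent_step[OF c t assms x no_acc[OF c x]] .
  qed
  then obtain c where c: "consistent (2 ^ (m - 1)) c" by blast
  obtain x where x: "x \<in> D" "T x = 2 ^ (m - 1)"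
    using element_exists[of "2 ^ (m - 1)" 0] assms by auto
  then show False using late[of x] no_acc[OF c x] by simp
qed

end

section \<open>The tableau of an accepting run\<close>

context bounded_machine
begin

text \<open>The intended model has one element per address, with \<open>sym\<close> the true
  contents and \<open>lab\<close> the transition taken. From time \<open>N\<close> on
  \<open>acc\<close> holds and no label does; as the axioms on reading and updating need a label,
  they never constrain the cells after time \<open>N\<close>.\<close>

theorem tableau_if_run:
  assumes f: "f 0 = init M w" "\<And>i. i < N \<Longrightarrow> step M (f i) (f (Suc i))" "fst (f N) = accept M"
    and N: "N \<le> 2 ^ (m - 1)"
  shows "\<exists>acc lab sym pin. tableau M ls s w m ({..<2 ^ m} \<times> {..<2 ^ m}) fst snd acc lab sym pin"
proof -
  define K :: nat where "K = 2 ^ (m - 1) - 1"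
  define lidx where "lidx i = (SOME l. l < length ls \<and> fst (f i) = source (ls ! l) \<and>
     map scanned (snd (f i)) = reads (ls ! l) \<and>
     f (Suc i) = (target (ls ! l), map2 act (actions (ls ! l)) (snd (f i))))" for i
  have lidx: "lidx i < length ls" "fst (f i) = source (ls ! lidx i)"
     "map scanned (snd (f i)) = reads (ls ! lidx i)"
     "f (Suc i) = (target (ls ! lidx i), map2 act (actions (ls ! lidx i)) (snd (f i)))"
    if "i < N" for i
    using someI_ex[OF f(2)[OF that, unfolded step_iff]] unfolding lidx_def by blast+
  have len: "length (snd (f i)) = tapes M" if "i \<le> N" for i
  proof (cases i)
    case 0
    then show ?thesis using f(1) wf by (simp add: init_def tm_wf_def)
  next
    case (Suc k)
    then have k: "k < N" using that by simp
    from arg_cong[OF lidx(3)[OF k], of length] show ?thesis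
      using lidx(4)[OF k] lengths[OF lidx(1)[OF k]] by (simp add: Suc)
  qed
  define acc where "acc x \<longleftrightarrow> N \<le> fst x" for x :: "nat \<times> nat"
  define lab where "lab l x \<longleftrightarrow> fst x < N \<and> l = lidx (fst x)" for l and x :: "nat \<times> nat"
  define sym where "sym j a x \<longleftrightarrow>
    a = fst (snd (f (fst x)) ! j) (snd (snd (f (fst x)) ! j) + (int (snd x) - int K))"
    for j a and x :: "nat \<times> nat"
  \<comment> \<open>Each input cell has its own pin, whereas the pin \<open>length w\<close> covers
    the whole half-line after the input, as \<open>last_pin\<close> requires.\<close>
  define pin where "pin i x \<longleftrightarrow> (if i < length w then snd x = K + i else K + i \<le> snd x)"
    for i and x :: "nat \<times> nat"
  have init_sym: "a = word_tape w (int p - int K)" if "sym 0 a (0, p)" for a p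
    using that by (simp add: sym_def f(1) init_def)
  have "tableau M ls s w m ({..<2 ^ m} \<times> {..<2 ^ m}) fst snd acc lab sym pin"
  proof (unfold_locales, goal_cases)
    case (1 x)
    then show ?case using N by (simp add: acc_def)
  next
    case (2 x)
    then show ?case by (simp add: pin_def K_def)
  next
    case (3 x l j)
    then have x: "fst x < N" "l = lidx (fst x)" by (auto simp: lab_def)
    have "reads (ls ! l) ! j = scanned (snd (f (fst x)) ! j)"
      using lidx(3)[OF x(1)] len[of "fst x"] x 3 by (metis less_imp_le nth_map)
    then show ?case using 3 by (cases "snd (f (fst x)) ! j") (simp add: sym_def K_def)
  next
    case (4 x)
    then show ?case using lidx(1)[of "fst x"] by (auto simp: acc_def lab_def)
  next
    case 5
    then show ?case by (intro bexI[of _ "(0, 0)"]) auto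
  next
    case (6 x)
    then show ?case by (intro bexI[of _ "(fst x, (snd x + 1) mod 2 ^ m)"]) auto
  next
    case (7 x)
    then show ?case by (intro bexI[of _ "((fst x + 1) mod 2 ^ m, snd x)"]) auto
  next
    case (8 x y)
    then show ?case by (simp add: acc_def)
  next
    case (9 x y l)
    then show ?case by (simp add: lab_def)
  next
    case (10 x y l l')
    then have "fst x < N" "l = lidx (fst x)" "Suc (fst x) < N" "l' = lidx (Suc (fst x))"
      by (auto simp: lab_def)
    then show ?case using lidx(2)[of "Suc (fst x)"] lidx(4)[of "fst x"] by simp
  next
    case (11 x y l)
    then have "fst x < N" "l = lidx (fst x)" "Suc (fst x) = N"
      by (auto simp: lab_def acc_def)
    then show ?case using lidx(4)[of "fst x"] f(3) by auto
  next
    case (12 x y l j a)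
    then have x: "fst x < N" "l = lidx (fst x)" by (auto simp: lab_def)
    obtain b d where bd: "actions (ls ! l) ! j = (b, d)" by fastforce
    obtain g h where gh: "snd (f (fst x)) ! j = (g, h)" by fastforce
    have "j < length (snd (f (fst x)))" "j < length (actions (ls ! l))"
      using len[of "fst x"] lengths(2)[OF 12(4)] x(1) 12(5) by auto
    moreover have "snd (f (fst y)) = map2 act (actions (ls ! l)) (snd (f (fst x)))"
      using lidx(4)[OF x(1)] 12(3) x(2) by simp
    ultimately have new: "snd (f (fst y)) ! j = (g(h := b), shift d h)"
      by (simp add: bd gh)
    have e: "shift d h + (int (snd y) - int K) = h + (int (snd x) - int K)"
      using 12(7) by (cases d) (simp_all add: bd)
    have "a = (g(h := b)) (shift d h + (int (snd y) - int K))"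
      using 12(9) by (simp add: sym_def new)
    then have "a = (g(h := b)) (h + (int (snd x) - int K))" unfolding e .
    then show ?case unfolding K_def[symmetric] by (auto simp: bd sym_def gh split: if_splits)
  next
    case (13 x y i)
    then show ?case by (auto simp: pin_def)
  next
    case (14 x y)
    then show ?case by (auto simp: pin_def)
  next
    case (15 x a)
    then have "snd x < K" by (simp add: K_def)
    then show ?case using 15 init_sym[of a "snd x"] by (cases x) (auto simp: word_tape_def)
  next
    case (16 x j a)
    then show ?case by (simp add: sym_def f(1) init_def nth_Cons')
  next
    case (17 x l)
    then show ?case using lidx(2)[of 0] f(1) by (auto simp: lab_def init_def)
  next
    case (18 x)
    then show ?case using f(1,3) by (simp add: acc_def init_def)
  next
    case (19 x i a)
    then show ?case using init_sym[of a "snd x"] by (cases x) (auto simp: word_tape_def pin_def)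
  next
    case (20 x a)
    then show ?case using init_sym[of a "snd x"] by (cases x) (auto simp: word_tape_def pin_def)
  qed
  then show ?thesis by blast
qed

end

section \<open>The tableau axioms as a formula\<close>

text \<open>The relation symbol \<open>7 * k + c + 7\<close> is bit \<open>k\<close> of a number, the time for \<open>c = 0\<close> and the
  position for \<open>c = 2\<close>, and \<open>7 * k + c + 8\<close> is the carry into this bit when the number is
  incremented.  The remaining symbols are \<open>0\<close> for \<open>acc\<close>, \<open>7 * l + 5\<close> for \<open>lab l\<close>,
  \<open>7 * prod_encode (j, a) + 6\<close> for \<open>sym j a\<close> and \<open>7 * i + 11\<close> for \<open>pin i\<close>.  As a loop over the bits
  ends with the index \<open>m\<close>, the most significant bit is then the symbol \<open>7 * m + c\<close>.\<close>

definition number :: "nat \<Rightarrow> (nat \<Rightarrow> 'a list set) \<Rightarrow> nat \<Rightarrow> 'a \<Rightarrow> nat" where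
  "number m I c a = val m (\<lambda>k. [a] \<in> I (7 * k + (c + 7)))"

text \<open>The range includes \<open>k = m\<close>: the carry out of the number signals
  overflow.\<close>

definition carries :: "nat \<Rightarrow> (nat \<Rightarrow> 'a list set) \<Rightarrow> nat \<Rightarrow> 'a \<Rightarrow> bool" where
  "carries m I c a \<longleftrightarrow> (\<forall>k \<le> m. [a] \<in> I (7 * k + (c + 8)) \<longleftrightarrow> (\<forall>i < k. [a] \<in> I (7 * i + (c + 7))))"

lemma number_less: "number m I c a < 2 ^ m"
  by (simp add: number_def val_less)

text \<open>The conjunction over all lower bits becomes a recurrence, each carry being the
  conjunction of the previous carry and bit, so that one constant template per bit suffices. The
  offset \<open>c + 15\<close> is \<open>c + 8\<close> at the next index.\<close>

lemma carries_iff: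
  "carries m I c a \<longleftrightarrow> [a] \<in> I (c + 8) \<and> (\<forall>k < m. [a] \<in> I (7 * k + (c + 15)) \<longleftrightarrow>
     [a] \<in> I (7 * k + (c + 8)) \<and> [a] \<in> I (7 * k + (c + 7)))" (is "?l \<longleftrightarrow> ?r")
proof -
  have S: "7 * Suc k + (c + 8) = 7 * k + (c + 15)" for k by simp
  show ?thesis
  proof
    assume l: ?l
    have "[a] \<in> I (7 * k + (c + 15)) \<longleftrightarrow> [a] \<in> I (7 * k + (c + 8)) \<and> [a] \<in> I (7 * k + (c + 7))"
      if "k < m" for k
      using l[unfolded carries_def, rule_format, of k] that
        l[unfolded carries_def, rule_format, of "Suc k", unfolded S] by (auto simp: less_Suc_eq)
    moreover have "[a] \<in> I (c + 8)"
      using l[unfolded carries_def, rule_format, of 0] by simp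
    ultimately show ?r by blast
  next
    assume r: ?r
    have "[a] \<in> I (7 * k + (c + 8)) \<longleftrightarrow> (\<forall>i < k. [a] \<in> I (7 * i + (c + 7)))" if "k \<le> m" for k
      using that
    proof (induction k)
      case 0
      then show ?case using r by simp
    next
      case (Suc k)
      then have "[a] \<in> I (7 * k + (c + 15)) \<longleftrightarrow>
        [a] \<in> I (7 * k + (c + 8)) \<and> [a] \<in> I (7 * k + (c + 7))" using r by simp
      then show ?case unfolding S using Suc by (auto simp: less_Suc_eq)
    qed
    then show ?l unfolding carries_def by blast
  qed
qed

lemma carries_overflow:
  "carries m I c a \<Longrightarrow> [a] \<in> I (7 * m + (c + 8)) \<longleftrightarrow> number m I c a = 2 ^ m - 1"
  unfolding carries_def number_def val_eq_max_iff by simp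

lemma carries_top:
  assumes "carries m I c a" "0 < m"
  shows "[a] \<in> I (7 * m + c) \<longleftrightarrow> 2 ^ (m - 1) \<le> number m I c a"
    "[a] \<in> I (7 * m + (c + 1)) \<and> [a] \<notin> I (7 * m + c) \<longleftrightarrow> number m I c a = 2 ^ (m - 1) - 1"
    "[a] \<notin> I (7 * m + (c + 1)) \<and> [a] \<notin> I (7 * m + c) \<longleftrightarrow> number m I c a < 2 ^ (m - 1) - 1"
proof -
  have e: "7 * m + c = 7 * (m - 1) + (c + 7)" "7 * m + (c + 1) = 7 * (m - 1) + (c + 8)"
    using assms(2) by simp_all
  have c: "[a] \<in> I (7 * (m - 1) + (c + 8)) \<longleftrightarrow> (\<forall>i < m - 1. [a] \<in> I (7 * i + (c + 7)))"
    using assms(1) unfolding carries_def by simp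
  show "[a] \<in> I (7 * m + c) \<longleftrightarrow> 2 ^ (m - 1) \<le> number m I c a"
    "[a] \<in> I (7 * m + (c + 1)) \<and> [a] \<notin> I (7 * m + c) \<longleftrightarrow> number m I c a = 2 ^ (m - 1) - 1"
    "[a] \<notin> I (7 * m + (c + 1)) \<and> [a] \<notin> I (7 * m + c) \<longleftrightarrow> number m I c a < 2 ^ (m - 1) - 1"
    unfolding e c number_def by (rule val_top_iff[OF assms(2)])+
qed

definition bits_zero :: "nat \<Rightarrow> nat \<Rightarrow> template" where
  "bits_zero c x = TNeg (TAtom True (c + 7) x)"

definition bits_eq :: "nat \<Rightarrow> nat \<Rightarrow> nat \<Rightarrow> template" where
  "bits_eq c x y = tiff (TAtom True (c + 7) x) (TAtom True (c + 7) y)"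

text \<open>The negated equivalence is an exclusive or: with \<open>bits_carry\<close> this is a
  half adder for the bit and the incoming carry of \<open>x\<close>.\<close>

definition bits_succ :: "nat \<Rightarrow> nat \<Rightarrow> nat \<Rightarrow> template" where
  "bits_succ c x y = tiff (TAtom True (c + 7) y)
     (TNeg (tiff (TAtom True (c + 7) x) (TAtom True (c + 8) x)))"

definition bits_carry :: "nat \<Rightarrow> nat \<Rightarrow> template" where
  "bits_carry c x = tiff (TAtom True (c + 15) x) (TAnd (TAtom True (c + 8) x) (TAtom True (c + 7) x))"

lemma sat_bits_zero:
  "(\<forall>i < m. sat D I s (inst i (bits_zero c x))) \<longleftrightarrow> number m I c (s x) = 0"
  by (simp add: bits_zero_def number_def val_eq_0_iff)

lemma sat_bits_eq:
  "(\<forall>i < m. sat D I s (inst i (bits_eq c x y))) \<longleftrightarrow> number m I c (s x) = number m I c (s y)"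
  by (simp add: bits_eq_def number_def val_eq_iff)

lemma sat_bits_succ:
  assumes "carries m I c (s x)"
  shows "(\<forall>i < m. sat D I s (inst i (bits_succ c x y))) \<longleftrightarrow>
    number m I c (s y) = (number m I c (s x) + 1) mod 2 ^ m"
  using assms unfolding number_def val_succ_iff[symmetric]
  by (auto simp: bits_succ_def carries_def)

text \<open>The bit templates express the successor modulo \<open>2 ^ m\<close> only. Requiring that
  the carry out is 0 as well yields the true successor, so that the last time or position is not
  tied to the first.\<close>

lemma succ_mod_iff:
  fixes a b :: nat
  assumes "a < 2 ^ m"
  shows "b = (a + 1) mod 2 ^ m \<and> a \<noteq> 2 ^ m - 1 \<longleftrightarrow> b = a + 1 \<and> b < 2 ^ m"
proof (cases "a + 1 = 2 ^ m")
  case True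
  then show ?thesis using assms by auto
next
  case False
  then have "a + 1 < 2 ^ m" using assms by linarith
  then show ?thesis using False by auto
qed

definition tall :: "nat \<Rightarrow> (nat \<Rightarrow> template) \<Rightarrow> template" where
  "tall n f = tconj (map f [0..<n])"

text \<open>Conditions on the machine itself are evaluated while the formula is built and enter it
  as truth values.\<close>

definition tconst :: "bool \<Rightarrow> template" where
  "tconst b = (if b then ttrue else TNeg ttrue)"

lemma sat_tall [simp]: "sat D I s (inst i (tall n f)) \<longleftrightarrow> (\<forall>k < n. sat D I s (inst i (f k)))"
  by (auto simp: tall_def)

lemma sat_tconst [simp]: "sat D I s (inst i (tconst b)) \<longleftrightarrow> b"
  by (simp add: tconst_def)

lemma vars_tall [simp]: "vars (tall n f) = insert 0 (\<Union>k < n. vars (f k))"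
  by (auto simp: tall_def)

lemma vars_tconst [simp]: "vars (tconst b) = {0}"
  by (simp add: tconst_def)

text \<open>A universal axiom whose premise contains a chain is written as the absence of a
  counterexample. Since \<open>u\<close> is read at index \<open>m\<close>, it can speak of top bits
  and overflows; the negated conclusion sits in \<open>u\<close> or in \<open>f\<close>.\<close>

definition no_pair :: "template \<Rightarrow> template \<Rightarrow> scheme \<Rightarrow> scheme" where
  "no_pair t u f = SNeg (SEx 0 (SEx 1 (ChainN t u f)))"

lemma sat_no_pair:
  "sat D I s (formula w m (no_pair t u f)) \<longleftrightarrow>
    (\<forall>x \<in> D. \<forall>y \<in> D. (\<forall>i < m. sat D I (s(0 := x, 1 := y)) (inst i t)) \<longrightarrow>
       sat D I (s(0 := x, 1 := y)) (inst m u) \<longrightarrow>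
       \<not> sat D I (s(0 := x, 1 := y)) (formula w m f))"
  by (auto simp: no_pair_def sat_ChainN)

lemma all_less_conj: "(\<forall>i < (m::nat). A i \<and> B i) \<longleftrightarrow> (\<forall>i < m. A i) \<and> (\<forall>i < m. B i)"
  by auto

text \<open>Meant for index \<open>m\<close>, where the two symbols are the carry into the top bit
  of the position and that bit itself.\<close>

definition center_atom :: template where
  "center_atom = TAnd (TAtom True 3 0) (TNeg (TAtom True 2 0))"

abbreviation acc_atom :: "nat \<Rightarrow> template" where
  "acc_atom \<equiv> TAtom False 0"
abbreviation lab_atom :: "nat \<Rightarrow> nat \<Rightarrow> template" where
  "lab_atom l \<equiv> TAtom False (7 * l + 5)"
abbreviation sym_atom :: "nat \<Rightarrow> nat \<Rightarrow> nat \<Rightarrow> template" where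
  "sym_atom j a \<equiv> TAtom False (7 * prod_encode (j, a) + 6)"

text \<open>Variable 0 is the earlier element and variable 1 the later one. When a head moves left,
  the positions of cells relative to it grow by one, so the later element has the successor
  position.\<close>

fun position_shift :: "move \<Rightarrow> template" where
  "position_shift MoveLeft = bits_succ 2 0 1"
| "position_shift Stay = bits_eq 2 0 1"
| "position_shift MoveRight = bits_succ 2 1 0"

fun no_overflow :: "move \<Rightarrow> template" where
  "no_overflow MoveLeft = TNeg (TAtom True 10 0)"
| "no_overflow Stay = ttrue"
| "no_overflow MoveRight = TNeg (TAtom True 10 1)"

section \<open>The axioms as schemes\<close>

context bounded_machine
begin

text \<open>Here the chain is the conclusion, hence the inner negation. The symbols 8 and 10 in the
  leaf are the carries into the lowest bits, which are true because an increment adds 1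
  there.\<close>

definition local_scheme :: scheme where
  "local_scheme = SNeg (SEx 0 (SEx 1 (SNeg (ChainN (TAnd (bits_carry 0 0) (bits_carry 2 0))
     (TAnd (timp (TAtom True 0 0) (acc_atom 0))
       (timp center_atom (TAnd (TAtom False 11 0) (tall (length ls) (\<lambda>l. tall (tapes M) (\<lambda>j.
          timp (lab_atom l 0) (sym_atom j (reads (ls ! l) ! j) 0)))))))
     (Leaf (TAnd (TAnd (TAtom False 8 0) (TAtom False 10 0))
       (timp (tall (length ls) (\<lambda>l. TNeg (lab_atom l 0))) (acc_atom 0))))))))"

definition origin_scheme :: scheme where
  "origin_scheme =
     SEx 0 (SEx 1 (ChainN (TAnd (bits_zero 0 0) (bits_zero 2 0)) ttrue (Leaf ttrue)))"

text \<open>Wrapping around at the last position spares an exception for it; the element demanded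
  there has position 0, which exists in the intended model.\<close>

definition next_position_scheme :: scheme where
  "next_position_scheme = SNeg (SEx 0 (SNeg (SEx 1
     (ChainN (TAnd (bits_eq 0 0 1) (bits_succ 2 0 1)) ttrue (Leaf ttrue)))))"

definition next_time_scheme :: scheme where
  "next_time_scheme = SNeg (SEx 0 (SNeg (SEx 1
     (ChainN (TAnd (bits_succ 0 0 1) (bits_eq 2 0 1)) ttrue (Leaf ttrue)))))"

definition broadcast_scheme :: scheme where
  "broadcast_scheme = no_pair (bits_eq 0 0 1)
     (TNeg (TAnd (timp (acc_atom 0) (acc_atom 1))
       (tall (length ls) (\<lambda>l. timp (lab_atom l 0) (lab_atom l 1))))) (Leaf ttrue)"

definition control_scheme :: scheme where
  "control_scheme = no_pair (bits_succ 0 0 1)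
     (TAnd (TNeg (TAtom True 8 0)) (TNeg (tall (length ls) (\<lambda>l. timp (lab_atom l 0)
       (TAnd (timp (acc_atom 1) (tconst (target (ls ! l) = accept M)))
         (tall (length ls) (\<lambda>l'. timp (lab_atom l' 1) (tconst (target (ls ! l) = source (ls ! l'))))))))))
     (Leaf ttrue)"

text \<open>The premise on the positions depends on the direction, so there is one axiom for each;
  \<open>tconst\<close> selects the transitions and tapes that move in direction
  \<open>d\<close>.\<close>

definition update_scheme :: "move \<Rightarrow> scheme" where
  "update_scheme d = no_pair (TAnd (bits_succ 0 0 1) (position_shift d))
     (TAnd (TAnd (TNeg (TAtom True 8 0)) (no_overflow d))
       (TNeg (tall (length ls) (\<lambda>l. tall (tapes M) (\<lambda>j. tall s (\<lambda>a.
          timp (tconst (snd (actions (ls ! l) ! j) = d)) (timp (lab_atom l 0) (timp (sym_atom j a 1)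
            (TAnd (timp center_atom (tconst (a = fst (actions (ls ! l) ! j))))
               (timp (TNeg center_atom) (sym_atom j a 0)))))))))))
     (Leaf ttrue)"

text \<open>The chain over the input is the conclusion, so it is negated in the place of
  \<open>f\<close>. The offset 18 is 11 at the next index, the pin of the next cell.\<close>

definition pin_scheme :: scheme where
  "pin_scheme = no_pair (bits_succ 2 0 1) (TNeg (TAtom True 10 0))
     (SNeg (ChainW (timp (TAtom True 11 0) (TAtom True 18 1)) (timp (TAtom True 11 0) (TAtom True 18 1))
       (timp (TAtom True 11 0) (TAtom True 11 1)) (Leaf ttrue)))"

definition init_scheme :: scheme where
  "init_scheme = no_pair (bits_zero 0 0)
     (TNeg (TAnd
       (TAnd
         (timp (TAnd (TNeg (TAtom True 3 0)) (TNeg (TAtom True 2 0)))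
           (tall s (\<lambda>a. timp (sym_atom 0 a 0) (tconst (a = 0)))))
         (tall (tapes M) (\<lambda>j. tall s (\<lambda>a. timp (sym_atom j a 0) (tconst (0 < j \<longrightarrow> a = 0))))))
       (TAnd
         (tall (length ls) (\<lambda>l. timp (lab_atom l 0) (tconst (source (ls ! l) = start M))))
         (timp (acc_atom 0) (tconst (start M = accept M))))))
     (Leaf ttrue)"

definition word_scheme :: scheme where
  "word_scheme = no_pair (bits_zero 0 0) ttrue
     (SNeg (ChainW
       (timp (TAtom True 11 0) (tall s (\<lambda>a. timp (sym_atom 0 a 0) (tconst (a = 1)))))
       (timp (TAtom True 11 0) (tall s (\<lambda>a. timp (sym_atom 0 a 0) (tconst (a = 2)))))
       (timp (TAtom True 11 0) (tall s (\<lambda>a. timp (sym_atom 0 a 0) (tconst (a = 0)))))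
       (Leaf ttrue)))"

definition run_scheme :: scheme where
  "run_scheme = SAnd local_scheme (SAnd origin_scheme (SAnd next_position_scheme
     (SAnd next_time_scheme (SAnd broadcast_scheme (SAnd control_scheme
     (SAnd (update_scheme MoveLeft) (SAnd (update_scheme Stay) (SAnd (update_scheme MoveRight)
     (SAnd pin_scheme (SAnd init_scheme word_scheme))))))))))"

lemmas scheme_defs = local_scheme_def origin_scheme_def next_position_scheme_def
  next_time_scheme_def broadcast_scheme_def control_scheme_def update_scheme_def pin_scheme_def
  init_scheme_def word_scheme_def

lemma scheme_fv_run_scheme: "scheme_fv run_scheme = {}"
  by (auto simp: run_scheme_def scheme_defs no_pair_def bits_zero_def bits_eq_def bits_succ_def
      bits_carry_def center_atom_def split: if_splits)

section \<open>The meaning of the schemes in a structure\<close>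

context
  fixes D :: "'a set" and I :: "nat \<Rightarrow> 'a list set" and w :: "bool list" and m :: nat
  assumes D: "D \<noteq> {}" and m: "0 < m"
begin

abbreviation "num \<equiv> number m I"
abbreviation "acc x \<equiv> [x] \<in> I 0"
abbreviation "lab l x \<equiv> [x] \<in> I (7 * l + 5)"
abbreviation "symb j a x \<equiv> [x] \<in> I (7 * prod_encode (j, a) + 6)"
abbreviation "pin i x \<equiv> [x] \<in> I (7 * i + 11)"

lemma center_atom_iff:
  assumes "carries m I 2 (t 0)"
  shows "sat D I t (inst m center_atom) \<longleftrightarrow> num 2 (t 0) = 2 ^ (m - 1) - 1"
  using carries_top(2)[OF assms m] by (simp add: center_atom_def)

text \<open>This axiom enforces the carries that the readings of the other schemes presuppose, so it
  is treated before they are assumed.\<close>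

lemma sat_local_scheme:
  "sat D I t (formula w m local_scheme) \<longleftrightarrow>
    (\<forall>x \<in> D. carries m I 0 x \<and> carries m I 2 x) \<and>
    (\<forall>x \<in> D. (2 ^ (m - 1) \<le> num 0 x \<longrightarrow> acc x) \<and>
      (num 2 x = 2 ^ (m - 1) - 1 \<longrightarrow> pin 0 x \<and>
        (\<forall>l < length ls. \<forall>j < tapes M. lab l x \<longrightarrow> symb j (reads (ls ! l) ! j) x)) \<and>
      (acc x \<or> (\<exists>l < length ls. lab l x)))"
proof -
  have "sat D I t (formula w m local_scheme) \<longleftrightarrow> (\<forall>x \<in> D. carries m I 0 x \<and> carries m I 2 x \<and>
      ([x] \<in> I (7 * m + 0) \<longrightarrow> acc x) \<and>
      ([x] \<in> I (7 * m + (2 + 1)) \<and> [x] \<notin> I (7 * m + 2) \<longrightarrow> pin 0 x \<and>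
        (\<forall>l < length ls. \<forall>j < tapes M. lab l x \<longrightarrow> symb j (reads (ls ! l) ! j) x)) \<and>
      (acc x \<or> (\<exists>l < length ls. lab l x)))"
    using D by (auto simp: local_scheme_def sat_ChainN carries_iff bits_carry_def center_atom_def)
  moreover have "carries m I 0 x \<and> carries m I 2 x \<and>
      ([x] \<in> I (7 * m + 0) \<longrightarrow> acc x) \<and>
      ([x] \<in> I (7 * m + (2 + 1)) \<and> [x] \<notin> I (7 * m + 2) \<longrightarrow> A) \<and> B \<longleftrightarrow>
    (carries m I 0 x \<and> carries m I 2 x) \<and> (2 ^ (m - 1) \<le> num 0 x \<longrightarrow> acc x) \<and>
      (num 2 x = 2 ^ (m - 1) - 1 \<longrightarrow> A) \<and> B" for x A B
    using carries_top(1)[OF _ m, of I 0 x] carries_top(2)[OF _ m, of I 2 x] by blast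
  ultimately show ?thesis by (simp only: ball_conj_distrib)
qed

context
  assumes c0: "\<And>x. x \<in> D \<Longrightarrow> carries m I 0 x" and c2: "\<And>x. x \<in> D \<Longrightarrow> carries m I 2 x"
begin

lemma sat_time_succ:
  assumes "x \<in> D"
  shows "(\<forall>i < m. sat D I (t(0 := x, Suc 0 := y)) (inst i (bits_succ 0 0 (Suc 0)))) \<longleftrightarrow>
    num 0 y = (num 0 x + 1) mod 2 ^ m"
  using sat_bits_succ[of m I 0 "t(0 := x, Suc 0 := y)" 0 D "Suc 0"] c0[OF assms] by simp

lemma sat_position_succ:
  assumes "x \<in> D"
  shows "(\<forall>i < m. sat D I (t(0 := x, Suc 0 := y)) (inst i (bits_succ 2 0 (Suc 0)))) \<longleftrightarrow>
    num 2 y = (num 2 x + 1) mod 2 ^ m"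
  using sat_bits_succ[of m I 2 "t(0 := x, Suc 0 := y)" 0 D "Suc 0"] c2[OF assms] by simp

lemma sat_position_pred:
  assumes "y \<in> D"
  shows "(\<forall>i < m. sat D I (t(0 := x, Suc 0 := y)) (inst i (bits_succ 2 (Suc 0) 0))) \<longleftrightarrow>
    num 2 x = (num 2 y + 1) mod 2 ^ m"
  using sat_bits_succ[of m I 2 "t(0 := x, Suc 0 := y)" "Suc 0" D 0] c2[OF assms] by simp

lemma time_overflow: "x \<in> D \<Longrightarrow> [x] \<in> I (7 * m + 8) \<longleftrightarrow> num 0 x = 2 ^ m - 1"
  using carries_overflow[OF c0] by simp

lemma position_overflow: "x \<in> D \<Longrightarrow> [x] \<in> I (7 * m + 10) \<longleftrightarrow> num 2 x = 2 ^ m - 1"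
  using carries_overflow[OF c2] by simp

lemma num_succ_iff:
  "num c y = (num c x + 1) mod 2 ^ m \<and> num c x \<noteq> 2 ^ m - 1 \<longleftrightarrow> num c y = num c x + 1"
  using succ_mod_iff[OF number_less, of "num c y" m I c x] number_less[of m I c y] by blast

lemma sat_origin_scheme:
  "sat D I t (formula w m origin_scheme) \<longleftrightarrow> (\<exists>x \<in> D. num 0 x = 0 \<and> num 2 x = 0)"
  using D by (simp add: origin_scheme_def sat_ChainN all_less_conj sat_bits_zero) blast

lemma sat_next_position_scheme:
  "sat D I t (formula w m next_position_scheme) \<longleftrightarrow>
    (\<forall>x \<in> D. \<exists>y \<in> D. num 0 x = num 0 y \<and> num 2 y = (num 2 x + 1) mod 2 ^ m)"
  by (simp add: next_position_scheme_def sat_ChainN all_less_conj sat_bits_eq sat_position_succ)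

lemma sat_next_time_scheme:
  "sat D I t (formula w m next_time_scheme) \<longleftrightarrow>
    (\<forall>x \<in> D. \<exists>y \<in> D. num 0 y = (num 0 x + 1) mod 2 ^ m \<and> num 2 x = num 2 y)"
  by (simp add: next_time_scheme_def sat_ChainN all_less_conj sat_bits_eq sat_time_succ)

lemma sat_broadcast_scheme:
  "sat D I t (formula w m broadcast_scheme) \<longleftrightarrow>
    (\<forall>x \<in> D. \<forall>y \<in> D. num 0 x = num 0 y \<longrightarrow> (acc x \<longrightarrow> acc y) \<and>
       (\<forall>l < length ls. lab l x \<longrightarrow> lab l y))"
  by (simp add: broadcast_scheme_def sat_no_pair sat_bits_eq) blast

lemma sat_control_scheme:
  "sat D I t (formula w m control_scheme) \<longleftrightarrow>
    (\<forall>x \<in> D. \<forall>y \<in> D. num 0 y = num 0 x + 1 \<longrightarrow> (\<forall>l < length ls. lab l x \<longrightarrow>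
       (acc y \<longrightarrow> target (ls ! l) = accept M) \<and>
       (\<forall>l' < length ls. lab l' y \<longrightarrow> target (ls ! l) = source (ls ! l'))))"
  unfolding num_succ_iff[symmetric]
  by (simp add: control_scheme_def sat_no_pair sat_time_succ time_overflow) blast

lemma sat_update_scheme:
  "sat D I t (formula w m (update_scheme d)) \<longleftrightarrow>
    (\<forall>x \<in> D. \<forall>y \<in> D. num 0 y = num 0 x + 1 \<longrightarrow> int (num 2 x) = shift d (int (num 2 y)) \<longrightarrow>
       (\<forall>l < length ls. \<forall>j < tapes M. \<forall>a < s. snd (actions (ls ! l) ! j) = d \<longrightarrow> lab l x \<longrightarrow>
          symb j a y \<longrightarrow>
          (if num 2 x = 2 ^ (m - 1) - 1 then a = fst (actions (ls ! l) ! j) else symb j a x)))"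
proof -
  have sh: "(\<forall>i < m. sat D I (t(0 := x, Suc 0 := y)) (inst i (position_shift d))) \<and>
    sat D I (t(0 := x, Suc 0 := y)) (inst m (no_overflow d)) \<longleftrightarrow>
    int (num 2 x) = shift d (int (num 2 y))" if "x \<in> D" "y \<in> D" for x y
  proof (cases d)
    case MoveLeft
    have "int (num 2 x) = shift d (int (num 2 y)) \<longleftrightarrow> num 2 y = num 2 x + 1"
      by (auto simp: MoveLeft)
    then show ?thesis unfolding num_succ_iff[symmetric]
      using that by (simp add: MoveLeft sat_position_succ position_overflow)
  next
    case Stay
    then show ?thesis by (simp add: sat_bits_eq)
  next
    case MoveRight
    have "int (num 2 x) = shift d (int (num 2 y)) \<longleftrightarrow> num 2 x = num 2 y + 1"
      by (auto simp: MoveRight)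
    then show ?thesis unfolding num_succ_iff[symmetric]
      using that by (simp add: MoveRight sat_position_pred position_overflow)
  qed
  have c: "sat D I (t(0 := x, Suc 0 := y)) (inst m center_atom) \<longleftrightarrow> num 2 x = 2 ^ (m - 1) - 1"
    if "x \<in> D" for x y
    using center_atom_iff[of "t(0 := x, Suc 0 := y)"] c2 that by simp
  have "sat D I t (formula w m (update_scheme d)) \<longleftrightarrow>
    (\<forall>x \<in> D. \<forall>y \<in> D. num 0 y = (num 0 x + 1) mod 2 ^ m \<and> num 0 x \<noteq> 2 ^ m - 1 \<longrightarrow>
       (\<forall>i < m. sat D I (t(0 := x, Suc 0 := y)) (inst i (position_shift d))) \<and>
       sat D I (t(0 := x, Suc 0 := y)) (inst m (no_overflow d)) \<longrightarrow>
       (\<forall>l < length ls. \<forall>j < tapes M. \<forall>a < s. snd (actions (ls ! l) ! j) = d \<longrightarrow> lab l x \<longrightarrow>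
          symb j a y \<longrightarrow>
          (if num 2 x = 2 ^ (m - 1) - 1 then a = fst (actions (ls ! l) ! j) else symb j a x)))"
    by (simp add: update_scheme_def sat_no_pair all_less_conj sat_time_succ time_overflow c) blast
  then show ?thesis unfolding num_succ_iff using sh by (simp cong: ball_cong)
qed

lemma sat_pin_scheme:
  "sat D I t (formula w m pin_scheme) \<longleftrightarrow>
    (\<forall>x \<in> D. \<forall>y \<in> D. num 2 y = num 2 x + 1 \<longrightarrow>
       (\<forall>i < length w. pin i x \<longrightarrow> pin (Suc i) y) \<and> (pin (length w) x \<longrightarrow> pin (length w) y))"
proof -
  have S: "7 * i + 18 = 7 * Suc i + 11" for i :: nat by simp
  show ?thesis
    unfolding num_succ_iff[symmetric]
    by (simp add: pin_scheme_def sat_no_pair sat_ChainW sat_position_succ position_overflow S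
        del: mult_Suc_right) blast
qed

lemma sat_init_scheme:
  "sat D I t (formula w m init_scheme) \<longleftrightarrow>
    (\<forall>x \<in> D. num 0 x = 0 \<longrightarrow>
       (num 2 x < 2 ^ (m - 1) - 1 \<longrightarrow> (\<forall>a < s. symb 0 a x \<longrightarrow> a = 0)) \<and>
       (\<forall>j < tapes M. \<forall>a < s. symb j a x \<longrightarrow> 0 < j \<longrightarrow> a = 0) \<and>
       (\<forall>l < length ls. lab l x \<longrightarrow> source (ls ! l) = start M) \<and>
       (acc x \<longrightarrow> start M = accept M))"
proof -
  have "[x] \<notin> I (7 * m + 3) \<and> [x] \<notin> I (7 * m + 2) \<longleftrightarrow> num 2 x < 2 ^ (m - 1) - 1"
    if "x \<in> D" for x using carries_top(3)[OF c2[OF that] m] by simp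
  then show ?thesis using D
    by (simp add: init_scheme_def sat_no_pair sat_bits_zero del: One_nat_def cong: ball_cong) blast
qed

lemma sat_word_scheme:
  "sat D I t (formula w m word_scheme) \<longleftrightarrow>
    (\<forall>x \<in> D. num 0 x = 0 \<longrightarrow>
       (\<forall>i < length w. pin i x \<longrightarrow> (\<forall>a < s. symb 0 a x \<longrightarrow> a = (if w ! i then 2 else 1))) \<and>
       (pin (length w) x \<longrightarrow> (\<forall>a < s. symb 0 a x \<longrightarrow> a = 0)))"
  using D by (simp add: word_scheme_def sat_no_pair sat_bits_zero sat_ChainW if_distrib cong: if_cong)
    (auto split: if_splits)

lemma sat_run_scheme:
  "sat D I t (formula w m run_scheme) \<longleftrightarrow>
    tableau M ls s w m D (num 0) (num 2) (\<lambda>x. acc x) lab symb pin"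
proof -
  have c: "\<forall>x \<in> D. carries m I 0 x \<and> carries m I 2 x" using c0 c2 by blast
  have u: "(\<forall>x \<in> D. \<forall>y \<in> D. A x y \<longrightarrow> (\<forall>l < length ls. \<forall>j < tapes M. \<forall>a < s.
      B x y (snd (actions (ls ! l) ! j)) \<longrightarrow> C x y l j a)) \<longleftrightarrow>
    (\<forall>d. \<forall>x \<in> D. \<forall>y \<in> D. A x y \<longrightarrow> B x y d \<longrightarrow> (\<forall>l < length ls. \<forall>j < tapes M. \<forall>a < s.
      snd (actions (ls ! l) ! j) = d \<longrightarrow> C x y l j a))" for A B C
    by blast
  have d: "(\<forall>d. Q d) \<longleftrightarrow> Q MoveLeft \<and> Q Stay \<and> Q MoveRight" for Q
    by (metis move.exhaust)
  show ?thesis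
  proof
    assume sat: "sat D I t (formula w m run_scheme)"
    have local: "sat D I t (formula w m local_scheme)" using sat by (simp add: run_scheme_def)
    have origin: "sat D I t (formula w m origin_scheme)" using sat by (simp add: run_scheme_def)
    have pos: "sat D I t (formula w m next_position_scheme)" using sat by (simp add: run_scheme_def)
    have time: "sat D I t (formula w m next_time_scheme)" using sat by (simp add: run_scheme_def)
    have bc: "sat D I t (formula w m broadcast_scheme)" using sat by (simp add: run_scheme_def)
    have ctl: "sat D I t (formula w m control_scheme)" using sat by (simp add: run_scheme_def)
    have pn: "sat D I t (formula w m pin_scheme)" using sat by (simp add: run_scheme_def)
    have ini: "sat D I t (formula w m init_scheme)" using sat by (simp add: run_scheme_def)
    have wd: "sat D I t (formula w m word_scheme)" using sat by (simp add: run_scheme_def)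
    have up: "sat D I t (formula w m (update_scheme d))" for d
      using sat by (cases d) (simp_all add: run_scheme_def)
    show "tableau M ls s w m D (num 0) (num 2) (\<lambda>x. acc x) lab symb pin"
    proof (unfold_locales, goal_cases)
      case 1
      then show ?case using local[unfolded sat_local_scheme] by blast
    next
      case 2
      then show ?case using local[unfolded sat_local_scheme] by blast
    next
      case 3
      then show ?case using local[unfolded sat_local_scheme] by blast
    next
      case 4
      then show ?case using local[unfolded sat_local_scheme] by blast
    next
      case 5
      then show ?case using origin[unfolded sat_origin_scheme] by blast
    next
      case 6
      then show ?case using pos[unfolded sat_next_position_scheme] by blast
    next
      case 7
      then show ?case using time[unfolded sat_next_time_scheme] by blast
    next
      case 8
      then show ?case using bc[unfolded sat_broadcast_scheme] by blast
    next
      case 9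
      then show ?case using bc[unfolded sat_broadcast_scheme] by blast
    next
      case 10
      then show ?case using ctl[unfolded sat_control_scheme] by blast
    next
      case 11
      then show ?case using ctl[unfolded sat_control_scheme] by blast
    next
      case (12 x y l j a)
      then show ?case using up[unfolded sat_update_scheme, rule_format, of x y "snd (actions (ls ! l) ! j)" l j a] by simp
    next
      case 13
      then show ?case using pn[unfolded sat_pin_scheme] by blast
    next
      case 14
      then show ?case using pn[unfolded sat_pin_scheme] by blast
    next
      case 15
      then show ?case using ini[unfolded sat_init_scheme] by blast
    next
      case 16
      then show ?case using ini[unfolded sat_init_scheme] by blast
    next
      case 17
      then show ?case using ini[unfolded sat_init_scheme] by blast
    next
      case 18
      then show ?case using ini[unfolded sat_init_scheme] by blast
    next
      case 19
      then show ?case using wd[unfolded sat_word_scheme] by blast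
    next
      case 20
      then show ?case using wd[unfolded sat_word_scheme] by blast
    qed
  next
    assume "tableau M ls s w m D (num 0) (num 2) (\<lambda>x. acc x) lab symb pin"
    then interpret tableau M ls s w m D "num 0" "num 2" "\<lambda>x. acc x" lab symb pin .
    have "sat D I t (formula w m (update_scheme d))" for d
      unfolding sat_update_scheme using update by blast
    moreover have "sat D I t (formula w m local_scheme)"
      unfolding sat_local_scheme using c late center_pin center_reads labelled by blast
    moreover have "sat D I t (formula w m origin_scheme)"
      unfolding sat_origin_scheme using origin by blast
    moreover have "sat D I t (formula w m next_position_scheme)"
      unfolding sat_next_position_scheme using next_position by blast
    moreover have "sat D I t (formula w m next_time_scheme)"
      unfolding sat_next_time_scheme using next_time by blast
    moreover have "sat D I t (formula w m broadcast_scheme)"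
      unfolding sat_broadcast_scheme using broadcast_acc broadcast_lab by blast
    moreover have "sat D I t (formula w m control_scheme)"
      unfolding sat_control_scheme using next_acc next_lab by blast
    moreover have "sat D I t (formula w m pin_scheme)"
      unfolding sat_pin_scheme using next_pin last_pin by blast
    moreover have "sat D I t (formula w m init_scheme)"
      unfolding sat_init_scheme using init_left init_blank init_lab init_acc by blast
    moreover have "sat D I t (formula w m word_scheme)"
      unfolding sat_word_scheme using init_word init_right by blast
    ultimately show "sat D I t (formula w m run_scheme)"
      by (simp add: run_scheme_def)
  qed
qed

end

end

theorem accepting_run_if_satisfiable:
  assumes "satisfiable \<sigma> (formula w m run_scheme)" "0 < m"
  shows "\<exists>c. (step M)\<^sup>*\<^sup>* (init M w) c \<and> fst c = accept M"
proof -
  obtain D :: "nat set" and I where model: "is_model \<sigma> D I (formula w m run_scheme)"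
    using assms(1) by (auto simp: satisfiable_def)
  then obtain d where d: "d \<in> D" by (auto simp: is_model_def is_structure_def)
  then have ne: "D \<noteq> {}" by blast
  have sat: "sat D I (\<lambda>_. d) (formula w m run_scheme)"
    using model d by (auto simp: is_model_def)
  then have "sat D I (\<lambda>_. d) (formula w m local_scheme)" by (simp add: run_scheme_def)
  then have c: "\<forall>x \<in> D. carries m I 0 x \<and> carries m I 2 x"
    unfolding sat_local_scheme[OF ne assms(2)] by blast
  show ?thesis
    using tableau.accepting_run[OF iffD1[OF sat_run_scheme[OF ne assms(2)] sat] assms(2)] c by blast
qed

text \<open>The structure built here interprets every natural number as a unary relation, so it fits
  each set \<open>F\<close> of symbols.\<close>

theorem satisfiable_if_run:
  assumes f: "f 0 = init M w" "\<And>i. i < N \<Longrightarrow> step M (f i) (f (Suc i))" "fst (f N) = accept M"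
    and N: "N \<le> 2 ^ (m - 1)" and m: "0 < m"
  shows "satisfiable (unary_vocabulary F) (formula w m run_scheme)"
proof -
  define D :: "(nat \<times> nat) set" where "D = {..<2 ^ m} \<times> {..<2 ^ m}"
  obtain acc lab symb pin where tab: "tableau M ls s w m D fst snd acc lab symb pin"
    unfolding D_def using tableau_if_run[where f = f, OF f N] by blast
  \<comment> \<open>This inverts the numbering of the symbols: the residue modulo 7 gives the kind
    and the quotient the index. Symbol 0 shares its residue with the time bits, which start at 7,
    and is tested before them. Offsets from 7 to 11 make the quotient one too large.\<close>
  define holds where "holds R x =
    (if R = 0 then acc x
     else if R mod 7 = 5 then lab (R div 7) x
     else if R mod 7 = 6 then symb (fst (prod_decode (R div 7))) (snd (prod_decode (R div 7))) x
     else if R mod 7 = 4 then pin (R div 7 - 1) x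
     else if R mod 7 = 0 then bit (fst x) (R div 7 - 1)
     else if R mod 7 = 1 then \<forall>i < R div 7 - 1. bit (fst x) i
     else if R mod 7 = 2 then bit (snd x) (R div 7 - 1)
     else \<forall>i < R div 7 - 1. bit (snd x) i)" for R x
  define I where "I R = {[x] | x. x \<in> D \<and> holds R x}" for R
  have I: "[x] \<in> I R \<longleftrightarrow> holds R x" if "x \<in> D" for R x
    using that unfolding I_def by blast
  have mods: "(7 * k + 7) mod 7 = 0" "(7 * k + 8) mod 7 = 1" "(7 * k + 9) mod 7 = 2"
    "(7 * k + 10) mod 7 = 3" "(7 * k + 11) mod 7 = 4" "(7 * k + 5) mod 7 = 5" "(7 * k + 6) mod 7 = 6"
    and divs: "(7 * k + 7) div 7 = k + 1" "(7 * k + 8) div 7 = k + 1" "(7 * k + 9) div 7 = k + 1"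
    "(7 * k + 10) div 7 = k + 1" "(7 * k + 11) div 7 = k + 1" "(7 * k + 5) div 7 = k"
    "(7 * k + 6) div 7 = k" for k :: nat
    by presburger+
  have h: "holds 0 x = acc x" "holds (7 * k + 5) x = lab k x"
    "holds (7 * prod_encode (j, a) + 6) x = symb j a x" "holds (7 * k + 11) x = pin k x"
    "holds (7 * k + 7) x = bit (fst x) k" "holds (7 * k + 8) x = (\<forall>i < k. bit (fst x) i)"
    "holds (7 * k + 9) x = bit (snd x) k" "holds (7 * k + 10) x = (\<forall>i < k. bit (snd x) i)"
    for k j a x
    unfolding holds_def mods divs by simp_all
  have "(0, 0) \<in> D" by (simp add: D_def)
  then have ne: "D \<noteq> {}" by blast
  have c: "carries m I 0 x" "carries m I 2 x" if "x \<in> D" for x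
    using that by (simp_all add: carries_def I h)
  have num: "number m I 0 x = fst x" "number m I 2 x = snd x" if "x \<in> D" for x
    using that by (auto simp: number_def I h val_bit D_def take_bit_nat_eq_self)
  have tab': "tableau M ls s w m D (number m I 0) (number m I 2) (\<lambda>x. [x] \<in> I 0)
      (\<lambda>l x. [x] \<in> I (7 * l + 5)) (\<lambda>j a x. [x] \<in> I (7 * prod_encode (j, a) + 6))
      (\<lambda>i x. [x] \<in> I (7 * i + 11))"
  proof -
    interpret t: tableau M ls s w m D fst snd acc lab symb pin by (rule tab)
    show ?thesis
    proof (unfold_locales, goal_cases)
      case (1 x)
      then show ?case using t.late[of x] by (simp add: I h num)
    next
      case (2 x)
      then show ?case using t.center_pin[of x] h(4)[of 0 x] by (simp add: I h num)
    next
      case (3 x l j)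
      then show ?case using t.center_reads[of x l j] by (simp add: I h num)
    next
      case (4 x)
      then show ?case using t.labelled[of x] by (simp add: I h num)
    next
      case 5
      then show ?case using t.origin by (auto simp: num)
    next
      case (6 x)
      then show ?case using t.next_position[of x] by (auto simp: num)
    next
      case (7 x)
      then show ?case using t.next_time[of x] by (auto simp: num)
    next
      case (8 x y)
      then show ?case using t.broadcast_acc[of x y] by (simp add: I h num)
    next
      case (9 x y l)
      then show ?case using t.broadcast_lab[of x y l] by (simp add: I h num)
    next
      case (10 x y l l')
      then show ?case using t.next_lab[of x y l l'] by (simp add: I h num)
    next
      case (11 x y l)
      then show ?case using t.next_acc[of x y l] by (simp add: I h num)
    next
      case (12 x y l j a)
      then show ?case using t.update[of x y l j a] by (simp add: I h num)
    next
      case (13 x y i)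
      then show ?case using t.next_pin[of x y i] by (simp add: I h num del: mult_Suc_right)
    next
      case (14 x y)
      then show ?case using t.last_pin[of x y] by (simp add: I h num)
    next
      case (15 x a)
      then show ?case using t.init_left[of x a] by (simp add: I h num)
    next
      case (16 x j a)
      then show ?case using t.init_blank[of x j a] by (simp add: I h num)
    next
      case (17 x l)
      then show ?case using t.init_lab[of x l] by (simp add: I h num)
    next
      case (18 x)
      then show ?case using t.init_acc[of x] by (simp add: I h num)
    next
      case (19 x i a)
      then show ?case using t.init_word[of x i a] by (simp add: I h num)
    next
      case (20 x a)
      then show ?case using t.init_right[of x a] by (simp add: I h num)
    qed
  qed
  have "sat D I t (formula w m run_scheme)" for t
    by (rule iffD2[OF sat_run_scheme[OF ne m] tab']) (auto simp: c)
  moreover have "is_structure (unary_vocabulary F) D I"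
    using ne by (auto simp: is_structure_def unary_vocabulary_def I_def split: if_splits)
  ultimately have "is_model (unary_vocabulary F) D I (formula w m run_scheme)"
    by (simp add: is_model_def)
  \<comment> \<open>The model consists of pairs; the Loewenheim-Skolem argument moves it to the
    natural numbers.\<close>
  then show ?thesis by (rule satisfiable_if_model)
qed

end

text \<open>The spare 1 turns into \<open>poly p n \<le> m - 1\<close> for
  \<open>m = (n + c) ^ d\<close>, so that the tableau has room for runs of length
  \<open>2 ^ poly p n\<close>.\<close>

lemma poly_le_power: "\<exists>c d. 1 \<le> c \<and> (\<forall>n. poly (p :: nat poly) n + 1 \<le> (n + c) ^ d)"
proof (induction p)
  case 0
  have "\<forall>n. poly (0 :: nat poly) n + 1 \<le> (n + 1) ^ 0" by simp
  then show ?case by blast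
next
  case (pCons a p)
  then obtain c d where c: "1 \<le> c" "\<And>n. poly p n + 1 \<le> (n + c) ^ d" by blast
  have "poly (pCons a p) n + 1 \<le> (n + (c + a + 1)) ^ Suc d" for n
  proof -
    have le: "poly p n + 1 \<le> (n + (c + a + 1)) ^ d"
      using c(2)[of n] power_mono[of "n + c" "n + (c + a + 1)" d] by linarith
    have "poly (pCons a p) n + 1 \<le> (a + 1 + n) * (poly p n + 1)" by (simp add: algebra_simps)
    also have "\<dots> \<le> (n + (c + a + 1)) * (n + (c + a + 1)) ^ d" using le by (intro mult_le_mono) auto
    finally show ?thesis by simp
  qed
  then show ?case using c(1) by (intro exI[of _ "c + a + 1"] exI[of _ "Suc d"]) auto
qed

theorem theorem4p5: "NEXPTIME_hard UCV_SAT"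
  unfolding NEXPTIME_hard_def
proof
  fix A assume "A \<in> NEXPTIME"
  then obtain M and p :: "nat poly" where M: "decides_in_time M A (\<lambda>n. 2 ^ poly p n)"
    by (auto simp: NEXPTIME_def)
  then have wf: "tm_wf M" by (simp add: decides_in_time_def)
  then have "finite (delta M)" by (simp add: tm_wf_def)
  then obtain ls where ls: "set ls = delta M" using finite_list by blast
  \<comment> \<open>One more than every symbol read; the inserted 0 keeps the maximum defined when
    nothing is read.\<close>
  define s where "s = Suc (Max (insert 0 (\<Union>\<tau> \<in> set ls. set (reads \<tau>))))"
  interpret bounded_machine M ls s
  proof
    fix l j assume l: "l < length ls" "j < tapes M"
    obtain q rs q' as where \<tau>: "ls ! l = ((q, rs), (q', as))" by (metis surj_pair)
    then have "((q, rs), (q', as)) \<in> delta M" using l ls nth_mem by metis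
    then have "length (reads (ls ! l)) = tapes M" using wf \<tau> by (auto simp: tm_wf_def reads_def)
    then have "reads (ls ! l) ! j \<in> set (reads (ls ! l))" "ls ! l \<in> set ls" using l by auto
    then have "reads (ls ! l) ! j \<in> insert 0 (\<Union>\<tau> \<in> set ls. set (reads \<tau>))" by blast
    then show "reads (ls ! l) ! j < s" unfolding s_def by (simp add: less_Suc_eq_le)
  qed (rule wf, rule ls)
  obtain c d where c: "1 \<le> c" "\<And>n. poly p n + 1 \<le> (n + c) ^ d" using poly_le_power by blast
  define m where "m w = (length w + c) ^ d" for w :: "bool list"
  define f where "f w = encode (formula w (m w) run_scheme)" for w
  have "polytime_computable f"
    using polytime_computable_cmds[OF c(1), of d "cmds run_scheme"]
    unfolding f_def m_def output_cmds .
  moreover have "w \<in> A \<longleftrightarrow> f w \<in> UCV_SAT" for w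
  proof
    have m: "0 < m w" "poly p (length w) \<le> m w - 1" using c(1) c(2)[of "length w"] by (auto simp: m_def)
    let ?\<phi> = "formula w (m w) run_scheme"
    assume "w \<in> A"
    then obtain c N where N: "(step M ^^ N) (init M w) c" "fst c = accept M"
      using M by (auto simp: decides_in_time_def rtranclp_power)
    \<comment> \<open>The time bound holds for all paths, hence for the accepting one.\<close>
    then have "N \<le> 2 ^ poly p (length w)" using M unfolding decides_in_time_def by blast
    also have "\<dots> \<le> 2 ^ (m w - 1)" using m(2) by simp
    finally have le: "N \<le> 2 ^ (m w - 1)" .
    obtain g where g: "g 0 = init M w" "g N = c" "\<And>i. i < N \<Longrightarrow> step M (g i) (g (Suc i))"
      using N(1) unfolding relpowp_fun_conv by blast
    obtain F where F: "finite F" "?\<phi> \<in> UCV (unary_vocabulary F) (unary_views F)"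
      using UCV_if_monadic[OF monadic_formula] by blast
    have "satisfiable (unary_vocabulary F) ?\<phi>"
      using satisfiable_if_run[of g w N "m w" F] g N(2) le m(1) by simp
    moreover have "fv ?\<phi> = {}" using fv_formula[of w "m w" run_scheme] scheme_fv_run_scheme by simp
    moreover have "finite (dom (unary_vocabulary F))"
      using F(1) by (rule finite_subset[rotated]) (auto simp: unary_vocabulary_def split: if_splits)
    moreover have "finite (unary_views F)" "\<forall>V \<in> unary_views F. is_view (unary_vocabulary F) V"
      using F(1) by (auto simp: unary_views_def unary_vocabulary_def)
    ultimately show "f w \<in> UCV_SAT" unfolding f_def UCV_SAT_def using F(2) by blast
  next
    assume "f w \<in> UCV_SAT"
    then obtain \<phi> \<sigma> where "encode (formula w (m w) run_scheme) = encode \<phi>" "satisfiable \<sigma> \<phi>"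
      by (auto simp: UCV_SAT_def f_def)
    \<comment> \<open>By injectivity the word encodes no other formula. The vocabulary is the one
      supplied by membership in \<open>UCV_SAT\<close>, so soundness has to cover an arbitrary
      \<open>\<sigma>\<close>.\<close>
    then have "satisfiable \<sigma> (formula w (m w) run_scheme)" using inj_encode by (auto dest: injD)
    moreover have "0 < m w" using c(1) by (simp add: m_def)
    ultimately show "w \<in> A"
      using accepting_run_if_satisfiable M by (auto simp: decides_in_time_def)
  qed
  ultimately show "polytime_reducible A UCV_SAT" unfolding polytime_reducible_def by blast
qed

end
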